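(* For any $x\in W\rtimes\langle\delta\rangle$, there exists a $W$-conjugate $y$ of $x$ such that $y$ is convex (for $\Phi^+$) and $\Phi(y)=\Phi^y$, where $\Phi^y=\{\alpha\in\Phi : y(\alpha)=\alpha\}$.
   Context: $G$ is a reductive group over an algebraically closed field, $T\subseteq G$ a maximal torus, $B\supseteq T$ a Borel subgroup, $W=N_T/T$ the Weyl group ($N_T$ the normalizer of $T$ in $G$). $\Phi$ is the root system of $T$ in $G$, $\Phi^+$ the set of positive roots determined by $B$, $\Phi^-=-\Phi^+$, $\Delta$ the set of simple roots, $\mathbb{S}$ the set of simple reflections. $\delta$ is an automorphism of $G$ preserving $T$ and $B$; the induced automorphisms of $(W,\mathbb{S})$, $\Phi$, $\Phi^+$, $\Delta$ are also denoted $\delta$. For $x\in W\rtimes\langle\delta\rangle$ put $\Phi^\pm(x)=\{\gamma\in\Phi^\pm : x^i(\gamma)\in\Phi^\pm\text{ for all }i\in\mathbb{Z}\}$ and $\Phi(x)=\Phi^+(x)\sqcup\Phi^-(x)$. For $\gamma\in\Phi^\pm\setminus\Phi(x)$ put $n_x(\gamma)=\min\{i\in\mathbb{Z}_{\geq1} : x^i(\gamma)\in\Phi^\mp\}$, and $n_x(\gamma)=\infty$ for $\gamma\in\Phi(x)$. The element $x$ is quasi-convex (for $\Phi^+$) if (i) $\Phi(x)$ is a standard parabolic root subsystem, i.e. $\Phi(x)=\Phi\cap\mathbb{Z}J$ for some $J\subseteq\Delta$; and (ii) $n_x(\alpha+\beta)\leq\max\{n_x(\alpha),n_x(\beta)\}$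 for all $\alpha,\beta\in\Phi^+$ with $\alpha+\beta\in\Phi^+$. It is convex (for $\Phi^+$) if both $x$ and $x^{-1}$ are quasi-convex. *)

theory Defs
  imports Complex_Main "HOL-Library.Extended_Nat"
begin

text \<open>
  A connected reductive group \<open>G\<close> over an algebraically closed field with maximal torus \<open>T\<close> enters
  through its root datum: \<open>'x\<close> is the character lattice \<open>X(T)\<close>, \<open>'y\<close> the cocharacter lattice,
  \<open>p\<close> the pairing, \<open>R\<close> the roots of \<open>T\<close> in \<open>G\<close>, \<open>c\<close> the map from roots to coroots. A Borel subgroup
  containing \<open>T\<close> enters as the system \<open>P\<close> of positive roots that it determines.
\<close>

section \<open>Root data\<close>

text \<open>The action of the integers on an abelian group.\<close>

definition int_scale :: "int \<Rightarrow> 'a::ab_group_add \<Rightarrow> 'a" where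
  "int_scale n a = (((+) a) ^^ nat n) 0 - (((+) a) ^^ nat (- n)) 0"

abbreviation int_span :: "'a::ab_group_add set \<Rightarrow> 'a set" where
  "int_span \<equiv> module.span int_scale"

lemma funpow_plus_add:
  fixes a :: "'a::ab_group_add"
  shows "(((+) a) ^^ (m + n)) 0 = (((+) a) ^^ m) 0 + (((+) a) ^^ n) 0"
  by (induction m) (auto simp: add.assoc)

lemma int_scale_diff: "int_scale (int m - int n) a = (((+) a) ^^ m) 0 - (((+) a) ^^ n) 0"
proof (cases "n \<le> m")
  case True
  then obtain d where "m = d + n" by (metis le_add_diff_inverse2)
  then show ?thesis by (simp add: int_scale_def funpow_plus_add)
next
  case False
  then obtain d where "n = d + m" by (metis le_add_diff_inverse2 nat_le_linear)
  then show ?thesis by (simp add: int_scale_def funpow_plus_add)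
qed

lemma int_scale_add_left: "int_scale (i + j) a = int_scale i a + int_scale j a"
proof -
  obtain m n m' n' where ij: "i = int m - int n" "j = int m' - int n'"
    by (metis int_diff_cases)
  then have "i + j = int (m + m') - int (n + n')" by simp
  then show ?thesis
    by (simp only: ij int_scale_diff funpow_plus_add) simp
qed

lemma int_scale_add_right: "int_scale i (a + b) = int_scale i a + int_scale i b"
proof -
  have "(((+) (a + b)) ^^ n) 0 = (((+) a) ^^ n) 0 + (((+) b) ^^ n) 0" for n
    by (induction n) (auto simp: algebra_simps)
  then show ?thesis by (simp add: int_scale_def algebra_simps)
qed

lemma int_scale_0 [simp]: "int_scale 0 a = 0"
  and int_scale_1 [simp]: "int_scale 1 a = a"
  by (simp_all add: int_scale_def)

lemma int_scale_minus: "int_scale (- i) a = - int_scale i a"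
  by (simp add: int_scale_def)

lemma int_scale_mult: "int_scale (i * j) a = int_scale i (int_scale j a)"
proof (induction i rule: int_induct [where k = 0])
  case base
  then show ?case by simp
next
  case (step1 i)
  then show ?case by (simp add: distrib_right int_scale_add_left)
next
  case (step2 i)
  have "int_scale (i - 1) b = int_scale i b - b" for b :: 'a
    using int_scale_add_left [of i "- 1" b] by (simp add: int_scale_minus)
  moreover have "int_scale ((i - 1) * j) a = int_scale (i * j) a - int_scale j a"
    using int_scale_add_left [of "i * j" "- j" a] by (simp add: int_scale_minus algebra_simps)
  ultimately show ?case using step2 by simp
qed

lemma module_int_scale: "module int_scale"
  by (simp add: module_def int_scale_add_left int_scale_add_right int_scale_mult)

text \<open>The pairing is bilinear, and identifies each lattice with the dual of the other.\<close>

definition perfect_pairing :: "('x::ab_group_add \<Rightarrow> 'y::ab_group_add \<Rightarrow> int) \<Rightarrow> bool" where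
  "perfect_pairing p \<longleftrightarrow>
     bij_betw (\<lambda>a. p a) UNIV {f. additive f} \<and>
     bij_betw (\<lambda>b a. p a b) UNIV {f. additive f}"

definition reflection ::
    "('x::ab_group_add \<Rightarrow> 'y \<Rightarrow> int) \<Rightarrow> ('x \<Rightarrow> 'y) \<Rightarrow> 'x \<Rightarrow> 'x \<Rightarrow> 'x" where
  "reflection p c \<alpha> a = a - int_scale (p a (c \<alpha>)) \<alpha>"

definition coreflection ::
    "('x \<Rightarrow> 'y::ab_group_add \<Rightarrow> int) \<Rightarrow> ('x \<Rightarrow> 'y) \<Rightarrow> 'x \<Rightarrow> 'y \<Rightarrow> 'y" where
  "coreflection p c \<alpha> b = b - int_scale (p \<alpha> b) (c \<alpha>)"

text \<open>
  The two lattices are finitely generated; they are then free, since the pairing is perfect.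
  The roots need not span the character lattice, even rationally.
\<close>

definition root_datum ::
    "('x::ab_group_add \<Rightarrow> 'y::ab_group_add \<Rightarrow> int) \<Rightarrow> 'x set \<Rightarrow> ('x \<Rightarrow> 'y) \<Rightarrow> bool" where
  "root_datum p R c \<longleftrightarrow>
     (\<exists>S :: 'x set. finite S \<and> int_span S = UNIV) \<and>
     (\<exists>S :: 'y set. finite S \<and> int_span S = UNIV) \<and>
     perfect_pairing p \<and>
     finite R \<and> inj_on c R \<and>
     (\<forall>\<alpha>\<in>R. p \<alpha> (c \<alpha>) = 2 \<and> reflection p c \<alpha> ` R = R \<and> coreflection p c \<alpha> ` c ` R = c ` R)"

definition reduced :: "'x::ab_group_add set \<Rightarrow> bool" where
  "reduced R \<longleftrightarrow>
     (\<forall>\<alpha>\<in>R. \<forall>\<beta>\<in>R. \<forall>m n. m \<noteq> 0 \<and> int_scale m \<alpha> = int_scale n \<beta> \<longrightarrow> \<beta> = \<alpha> \<or> \<beta> = - \<alpha>)"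

text \<open>
  The Borel subgroups containing \<open>T\<close> correspond to the Weyl chambers, and every Weyl chamber contains
  a cocharacter.
\<close>

definition positive_system ::
    "('x \<Rightarrow> 'y \<Rightarrow> int) \<Rightarrow> 'x set \<Rightarrow> 'x set \<Rightarrow> bool" where
  "positive_system p R P \<longleftrightarrow>
     (\<exists>l. (\<forall>\<alpha>\<in>R. p \<alpha> l \<noteq> 0) \<and> P = {\<alpha> \<in> R. p \<alpha> l > 0})"

definition simple_roots :: "'x::ab_group_add set \<Rightarrow> 'x set" where
  "simple_roots P = {\<alpha> \<in> P. \<not> (\<exists>\<beta>\<in>P. \<exists>\<gamma>\<in>P. \<alpha> = \<beta> + \<gamma>)}"

text \<open>
  The second line says that the transpose of \<open>\<delta>\<close> on cocharacters carries the coroot of \<open>\<delta> \<alpha>\<close>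
  to the coroot of \<open>\<alpha>\<close>.
\<close>

definition based_automorphism ::
    "('x::ab_group_add \<Rightarrow> 'y \<Rightarrow> int) \<Rightarrow> 'x set \<Rightarrow> ('x \<Rightarrow> 'y) \<Rightarrow> 'x set \<Rightarrow> ('x \<Rightarrow> 'x) \<Rightarrow> bool" where
  "based_automorphism p R c P \<delta> \<longleftrightarrow>
     bij \<delta> \<and> additive \<delta> \<and> \<delta> ` R = R \<and> \<delta> ` P = P \<and>
     (\<forall>\<alpha>\<in>R. \<forall>a. p (\<delta> a) (c (\<delta> \<alpha>)) = p a (c \<alpha>))"

section \<open>The Weyl group and its extension\<close>

text \<open>
  The Weyl group in its faithful action on the character lattice. Closure under inverses is
  automatic since reflections are involutions.
\<close>

inductive_set weyl_group ::
    "('x::ab_group_add \<Rightarrow> 'y \<Rightarrow> int) \<Rightarrow> 'x set \<Rightarrow> ('x \<Rightarrow> 'y) \<Rightarrow> ('x \<Rightarrow> 'x) set"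
  for p :: "'x::ab_group_add \<Rightarrow> 'y \<Rightarrow> int" and R :: "'x set" and c :: "'x \<Rightarrow> 'y" where
  id: "id \<in> weyl_group p R c"
| refl: "\<alpha> \<in> R \<Longrightarrow> w \<in> weyl_group p R c \<Longrightarrow> reflection p c \<alpha> \<circ> w \<in> weyl_group p R c"

definition fun_pow_int :: "('a \<Rightarrow> 'a) \<Rightarrow> int \<Rightarrow> 'a \<Rightarrow> 'a" where
  "fun_pow_int f i = (if i \<ge> 0 then f ^^ nat i else inv f ^^ nat (- i))"

text \<open>
  The product of the Weyl group and the cyclic group generated by \<open>\<delta>\<close> inside the automorphism
  group of the character lattice. It is semidirect: \<open>\<delta>\<close> normalizes the Weyl group, and no
  element of the Weyl group other than the identity preserves the positive roots.
\<close>

definition extended_weyl_group ::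
    "('x::ab_group_add \<Rightarrow> 'y \<Rightarrow> int) \<Rightarrow> 'x set \<Rightarrow> ('x \<Rightarrow> 'y) \<Rightarrow> ('x \<Rightarrow> 'x) \<Rightarrow> ('x \<Rightarrow> 'x) set" where
  "extended_weyl_group p R c \<delta> = {w \<circ> fun_pow_int \<delta> i | w i. w \<in> weyl_group p R c}"

section \<open>Convex elements\<close>

definition roots_staying_in :: "'x set \<Rightarrow> ('x \<Rightarrow> 'x) \<Rightarrow> 'x set" where
  "roots_staying_in Q x = {\<gamma> \<in> Q. \<forall>i. fun_pow_int x i \<gamma> \<in> Q}"

definition stable_roots :: "'x::ab_group_add set \<Rightarrow> ('x \<Rightarrow> 'x) \<Rightarrow> 'x set" where
  "stable_roots P x = roots_staying_in P x \<union> roots_staying_in (uminus ` P) x"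

definition fixed_roots :: "'x set \<Rightarrow> ('x \<Rightarrow> 'x) \<Rightarrow> 'x set" where
  "fixed_roots R x = {\<alpha> \<in> R. x \<alpha> = \<alpha>}"

text \<open>
  Only used for roots \<open>\<gamma>\<close>. The minimum is over a nonempty set, since \<open>x\<close> permutes the finitely
  many roots.
\<close>

definition exit_time :: "'x::ab_group_add set \<Rightarrow> ('x \<Rightarrow> 'x) \<Rightarrow> 'x \<Rightarrow> enat" where
  "exit_time P x \<gamma> =
     (if \<gamma> \<in> stable_roots P x then \<infinity>
      else enat (LEAST i. i \<ge> 1 \<and> (x ^^ i) \<gamma> \<in> (if \<gamma> \<in> P then uminus ` P else P)))"

definition quasi_convex_element :: "'x::ab_group_add set \<Rightarrow> 'x set \<Rightarrow> ('x \<Rightarrow> 'x) \<Rightarrow> bool" where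
  "quasi_convex_element R P x \<longleftrightarrow>
     (\<exists>J \<subseteq> simple_roots P. stable_roots P x = R \<inter> int_span J) \<and>
     (\<forall>\<alpha>\<in>P. \<forall>\<beta>\<in>P. \<alpha> + \<beta> \<in> P \<longrightarrow>
        exit_time P x (\<alpha> + \<beta>) \<le> max (exit_time P x \<alpha>) (exit_time P x \<beta>))"

definition convex_element :: "'x::ab_group_add set \<Rightarrow> 'x set \<Rightarrow> ('x \<Rightarrow> 'x) \<Rightarrow> bool" where
  "convex_element R P x \<longleftrightarrow> quasi_convex_element R P x \<and> quasi_convex_element R P (inv x)"

end

theory Submission
  imports Defs "HOL-Library.FuncSet"
begin

text \<open>
  On the roots \<open>x\<close> has some finite order \<open>d\<close>, and the Fourier components of a generic cocharacter
  along the \<open>x\<close>-orbits are additive maps to the complex plane on which \<open>x\<close> acts by rotations.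
  For the real part of a nontrivial rotation, the exit time of a root with positive value is a
  decreasing function of its angle in the right half plane (for the anticlockwise direction), and
  the angle of a sum lies between the angles of the summands; this is quasi-convexity. Adding
  the components for the eigenvalues different from 1 with rapidly decreasing weights, that is,
  lexicographically, preserves quasi-convexity, and the resulting functional \<open>g\<close> vanishes exactly
  on the roots fixed by \<open>x\<close>. A last, still smaller, generic term makes it regular. Finally some
  element of the Weyl group carries the chamber of this functional to the given one. No
  condition involves the direction of rotation, so \<open>inv x\<close> is treated by the same functional.
\<close>

section \<open>Rotations of the plane\<close>

lemma right_half_plane_polar:
  assumes "Re z > 0"
  obtains r t where "r > 0" "- pi / 2 < t" "t < pi / 2" "z = rcis r t"
proof -
  have c: "cos (Arg z) > 0"
    using assms rcis_cmod_Arg [of z] Re_rcis [of "cmod z" "Arg z"]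
    by (metis norm_ge_zero order_le_less zero_less_mult_pos mult_eq_0_iff)
  have z: "z \<noteq> 0" using assms by auto
  have b: "- pi < Arg z" "Arg z \<le> pi" using Arg_bounded [of z] by auto
  have "\<bar>Arg z\<bar> < pi / 2"
  proof (rule ccontr)
    assume "\<not> \<bar>Arg z\<bar> < pi / 2"
    then have "cos \<bar>Arg z\<bar> \<le> cos (pi / 2)"
      using b by (intro cos_monotone_0_pi_le) auto
    then show False using c by simp
  qed
  then show ?thesis
    using that [of "cmod z" "Arg z"] z rcis_cmod_Arg [of z] by auto
qed

text \<open>The open left half plane fills the angles between \<open>pi / 2\<close> and
  \<open>3 * pi / 2\<close>, an interval of length \<open>pi\<close>. Steps of size at most
  \<open>pi\<close> cannot jump over it, so the first angle beyond \<open>pi / 2\<close> lies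
  inside.\<close>

lemma rotation_exit:
  fixes s t :: real
  assumes "0 < t" "t \<le> pi" "- pi / 2 < s" "s < pi / 2" "pi / 2 < s + real m * t"
  shows "\<exists>n\<le>m. cos (s + real n * t) < 0"
proof -
  define n where "n = (LEAST n. pi / 2 < s + real n * t)"
  have n: "pi / 2 < s + real n * t" unfolding n_def by (rule LeastI) (fact assms(5))
  have "n \<le> m" unfolding n_def by (rule Least_le) (fact assms(5))
  moreover have "n \<noteq> 0" using n assms by (intro notI) simp
  then obtain k where k: "n = Suc k" by (cases n) auto
  have "\<not> pi / 2 < s + real k * t" unfolding n_def
    using not_less_Least [of k "\<lambda>n. pi / 2 < s + real n * t"] k n_def by auto
  then have up: "s + real n * t \<le> pi / 2 + t" by (simp add: k algebra_simps)
  \<comment> \<open>For \<open>t = pi\<close> the bound \<open>up\<close> alone is not strict. If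
    the first step already leaves, \<open>s < pi / 2\<close> gives strictness; otherwise an earlier
    full step stayed within an interval shorter than \<open>pi\<close>, which forces
    \<open>t < pi\<close>.\<close>
  have "s + real n * t < 3 * pi / 2"
  proof (cases "k = 0")
    case True
    then show ?thesis using k assms by simp
  next
    case False
    then have "t \<le> real k * t" using assms by simp
    then have "t < pi" using \<open>\<not> pi / 2 < s + real k * t\<close> assms by linarith
    then show ?thesis using up by simp
  qed
  then have "cos (s + real n * t - pi) > 0" using n by (intro cos_gt_zero_pi) auto
  then have "cos (s + real n * t) < 0" by simp
  ultimately show ?thesis by blast
qed

lemma Re_rotate: "Re (cis t ^ n * rcis r s) = r * cos (s + real n * t)"
proof -
  have "cis t ^ n * rcis r s = rcis r (s + real n * t)"
    by (simp add: DeMoivre rcis_def cis_mult algebra_simps)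
  then show ?thesis by simp
qed

text \<open>Turning anticlockwise, a larger starting angle passes \<open>pi / 2\<close> no later
  than a smaller one. The angle \<open>e\<close> of the sum is at least the smaller of
  \<open>u\<close> and \<open>v\<close>, so the sum has passed \<open>pi / 2\<close> once both
  summands have.\<close>

lemma rotate_sum_exit_cis:
  assumes t: "0 < t" "t \<le> pi" and z: "Re z > 0" and w: "Re w > 0"
    and a: "Re (cis t ^ a * z) < 0" and b: "Re (cis t ^ b * w) < 0"
  shows "\<exists>n\<le>max a b. Re (cis t ^ n * (z + w)) < 0"
proof -
  obtain r u where u: "r > 0" "- pi / 2 < u" "u < pi / 2" "z = rcis r u"
    using z by (rule right_half_plane_polar)
  obtain s v where v: "s > 0" "- pi / 2 < v" "v < pi / 2" "w = rcis s v"
    using w by (rule right_half_plane_polar)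
  have "Re (z + w) > 0" using z w by simp
  then obtain q e where e: "q > 0" "- pi / 2 < e" "e < pi / 2" "z + w = rcis q e"
    by (rule right_half_plane_polar)
  \<comment> \<open>The total angle never drops below the starting one, so a negative real part can
    only come from passing \<open>pi / 2\<close>.\<close>
  have leave: "pi / 2 < u' + real n * t"
    if "r' > 0" "- pi / 2 < u'" "Re (cis t ^ n * rcis r' u') < 0" for r' u' n
  proof (rule ccontr)
    assume c: "\<not> pi / 2 < u' + real n * t"
    have "0 \<le> real n * t" using t by simp
    then have "cos (u' + real n * t) \<ge> 0" using c that by (intro cos_ge_zero) auto
    then show False using that unfolding Re_rotate by (simp add: mult_less_0_iff)
  qed
  have "\<exists>m\<le>max a b. pi / 2 < e + real m * t"
  proof (cases "e \<ge> u \<or> e \<ge> v")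
    case True
    have "pi / 2 < u + real a * t" "pi / 2 < v + real b * t"
      using leave [of r u a] leave [of s v b] u v a b by auto
    with True have "pi / 2 < e + real a * t \<or> pi / 2 < e + real b * t" by auto
    then show ?thesis using max.cobounded1 max.cobounded2 by blast
  next
    case False
    \<comment> \<open>Rotating by \<open>- e\<close> makes the sum real. If \<open>e\<close> were
      below both angles, both rotated summands would have angle in \<open>(0, pi)\<close>, hence
      positive imaginary part, and these could not cancel.\<close>
    have "rcis q e * cis (- e) = rcis r u * cis (- e) + rcis s v * cis (- e)"
      using e(4) u(4) v(4) by (simp flip: distrib_right)
    then have "Im (rcis q e * cis (- e)) = Im (rcis r u * cis (- e)) + Im (rcis s v * cis (- e))"
      by (metis plus_complex.sel(2))
    then have "r * sin (u - e) + s * sin (v - e) = 0"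
      by (simp add: rcis_def cis_mult mult.assoc flip: scaleR_conv_of_real)
    moreover have "sin (u - e) > 0" "sin (v - e) > 0"
      using False u v e by (intro sin_gt_zero; linarith)+
    ultimately show ?thesis using u(1) v(1)
      add_pos_pos [of "r * sin (u - e)" "s * sin (v - e)"] by simp
  qed
  then obtain m where m: "m \<le> max a b" "pi / 2 < e + real m * t" by blast
  then obtain n where "n \<le> m" "cos (e + real n * t) < 0" using rotation_exit t e by blast
  then show ?thesis using e m
    unfolding e(4) Re_rotate by (intro exI [of _ n]) (auto simp: mult_less_0_iff)
qed

text \<open>Reduces every nontrivial rotation to an anticlockwise one by at most \<open>pi\<close>:
  a clockwise rotation becomes anticlockwise under complex conjugation, which leaves real parts
  unchanged.\<close>

lemma unit_complex_cases:
  assumes "cmod \<zeta> = 1" "\<zeta> \<noteq> 1"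
  obtains t where "0 < t" "t \<le> pi" "\<zeta> = cis t \<or> \<zeta> = cnj (cis t)"
proof -
  have z: "\<zeta> = cis (Arg \<zeta>)" using assms rcis_cmod_Arg [of \<zeta>] by (simp add: rcis_def)
  have b: "- pi < Arg \<zeta>" "Arg \<zeta> \<le> pi" using Arg_bounded [of \<zeta>] by auto
  have "Arg \<zeta> \<noteq> 0" using z assms by (metis cis_zero)
  then consider "Arg \<zeta> > 0" | "Arg \<zeta> < 0" by linarith
  then show ?thesis
  proof cases
    case 1
    then show ?thesis using that z b by blast
  next
    case 2
    then show ?thesis using that [of "- Arg \<zeta>"] z b by (simp add: cis_cnj)
  qed
qed

lemma Re_mult_cnj_power: "Re (cnj u ^ n * z) = Re (u ^ n * cnj z)"
proof -
  have "cnj u ^ n * z = cnj (u ^ n * cnj z)" by simp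
  then show ?thesis by (metis complex_cnj cnj.sel(1))
qed

lemma rotate_sum_exit:
  assumes \<zeta>: "cmod \<zeta> = 1" "\<zeta> \<noteq> 1" and z: "Re z > 0" and w: "Re w > 0"
    and a: "Re (\<zeta> ^ a * z) < 0" and b: "Re (\<zeta> ^ b * w) < 0"
  shows "\<exists>n\<le>max a b. Re (\<zeta> ^ n * (z + w)) < 0"
proof -
  obtain t where t: "0 < t" "t \<le> pi" "\<zeta> = cis t \<or> \<zeta> = cnj (cis t)"
    using \<zeta> by (rule unit_complex_cases)
  from t(3) show ?thesis
  proof
    assume "\<zeta> = cis t"
    then show ?thesis using rotate_sum_exit_cis t z w a b by blast
  next
    assume c: "\<zeta> = cnj (cis t)"
    then show ?thesis
      using rotate_sum_exit_cis [of t "cnj z" "cnj w" a b] t z w a b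
      unfolding c Re_mult_cnj_power complex_cnj_add by simp
  qed
qed

lemma rotate_exit:
  assumes \<zeta>: "cmod \<zeta> = 1" "\<zeta> \<noteq> 1" and z: "Re z > 0"
  shows "\<exists>n. Re (\<zeta> ^ n * z) < 0"
proof -
  obtain t where t: "0 < t" "t \<le> pi" "\<zeta> = cis t \<or> \<zeta> = cnj (cis t)"
    using \<zeta> by (rule unit_complex_cases)
  have main: "\<exists>n. Re (cis t ^ n * z) < 0" if z: "Re z > 0" for z
  proof -
    obtain r u where u: "r > 0" "- pi / 2 < u" "u < pi / 2" "z = rcis r u"
      using z by (rule right_half_plane_polar)
    obtain m where "pi / 2 - u < real m * t" using reals_Archimedean3 t by blast
    then have "pi / 2 < u + real m * t" by simp
    then obtain n where "cos (u + real n * t) < 0" using rotation_exit t u by blast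
    then show ?thesis using u(1) unfolding u(4) Re_rotate by (auto simp: mult_less_0_iff)
  qed
  from t(3) show ?thesis
  proof
    assume "\<zeta> = cis t"
    then show ?thesis using main z by blast
  next
    assume c: "\<zeta> = cnj (cis t)"
    then show ?thesis using main [of "cnj z"] z unfolding c Re_mult_cnj_power by simp
  qed
qed

section \<open>Sign patterns along orbits\<close>

lemma additive_funpow:
  fixes x :: "'a::ab_group_add \<Rightarrow> 'a"
  shows "additive x \<Longrightarrow> additive (x ^^ n)"
  by (induction n) (auto simp: additive_def)

lemma funpow_in:
  fixes x :: "'a \<Rightarrow> 'a"
  shows "x ` A \<subseteq> A \<Longrightarrow> a \<in> A \<Longrightarrow> (x ^^ n) a \<in> A"
  by (induction n) auto

lemma image_inv_eq:
  assumes "bij x" "x ` A = A"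
  shows "inv x ` A = A"
  using image_inv_f_f [OF bij_is_inj [OF assms(1)], of A] assms(2) by simp

lemma additive_automorphism_comp:
  fixes f h :: "'a::ab_group_add \<Rightarrow> 'a"
  assumes "bij f" "additive f" "f ` A = A" and "bij h" "additive h" "h ` A = A"
  shows "bij (f \<circ> h)" "additive (f \<circ> h)" "(f \<circ> h) ` A = A"
proof -
  show "bij (f \<circ> h)" using assms by (simp add: bij_comp)
  show "additive (f \<circ> h)" using assms by (simp add: additive_def)
  show "(f \<circ> h) ` A = A" using assms by (simp only: image_comp [symmetric])
qed

lemma additive_inv:
  assumes "bij x" "additive x"
  shows "additive (inv x)"
proof
  fix a b
  have "x (inv x a + inv x b) = a + b"
    using assms by (simp add: additive.add bij_is_surj surj_f_inv_f)
  then show "inv x (a + b) = inv x a + inv x b"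
    using assms(1) by (metis bij_is_inj inv_f_f)
qed

text \<open>As \<open>e\<close> tends to 0 from the right, \<open>g a + e * h a\<close> tends to
  \<open>g a\<close>, so nonzero signs are eventually kept, simultaneously at finitely many points.
  This realizes a lexicographic combination of \<open>g\<close> and \<open>h\<close> by a single
  real functional.\<close>

lemma perturb_sign:
  fixes g h :: "'a \<Rightarrow> real"
  assumes "finite A"
  shows "\<exists>e>0. \<forall>a\<in>A. g a \<noteq> 0 \<longrightarrow> sgn (g a + e * h a) = sgn (g a)"
proof -
  have "\<forall>\<^sub>F e in at_right 0. g a \<noteq> 0 \<longrightarrow> sgn (g a + e * h a) = sgn (g a)" for a
  proof (cases "g a = 0")
    case False
    have lim: "((\<lambda>e. g a + e * h a) \<longlongrightarrow> g a + 0 * h a) (at_right 0)"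
      by (intro tendsto_intros)
    show ?thesis
    proof (cases "g a > 0")
      case True
      then show ?thesis using order_tendstoD(1) [OF lim, of 0] by (auto elim: eventually_mono)
    next
      case neg: False
      then show ?thesis using order_tendstoD(2) [OF lim, of 0] False by (auto elim: eventually_mono)
    qed
  qed simp
  then have "\<forall>\<^sub>F e in at_right 0. \<forall>a\<in>A. g a \<noteq> 0 \<longrightarrow> sgn (g a + e * h a) = sgn (g a)"
    using assms by (intro eventually_ball_finite) auto
  moreover have "\<forall>\<^sub>F e in at_right (0::real). e > 0" by (rule eventually_at_right_less)
  ultimately have "\<forall>\<^sub>F e in at_right 0. e > 0 \<and>
      (\<forall>a\<in>A. g a \<noteq> 0 \<longrightarrow> sgn (g a + e * h a) = sgn (g a))"
    by (simp add: eventually_conj_iff)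
  then show ?thesis using eventually_happens' trivial_limit_at_right_real by blast
qed

text \<open>
  The third condition bounds the exit time of a sum: it suffices to speak of arbitrary negative
  values instead of first ones, because the bound for the minimal \<open>a\<close> and \<open>b\<close> is an instance.
\<close>

definition sign_convex :: "('a::ab_group_add \<Rightarrow> 'a) \<Rightarrow> 'a set \<Rightarrow> ('a \<Rightarrow> real) \<Rightarrow> bool" where
  "sign_convex x A g \<longleftrightarrow>
     (\<forall>\<gamma>\<in>A. g (x \<gamma>) = 0 \<longleftrightarrow> g \<gamma> = 0) \<and>
     (\<forall>\<gamma>\<in>A. g \<gamma> \<noteq> 0 \<longrightarrow> (\<exists>n. g ((x ^^ n) \<gamma>) * g \<gamma> < 0)) \<and>
     (\<forall>\<alpha>\<in>A. \<forall>\<beta>\<in>A. \<forall>a b. \<alpha> + \<beta> \<in> A \<longrightarrow> g \<alpha> > 0 \<longrightarrow> g \<beta> > 0 \<longrightarrow>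
        g ((x ^^ a) \<alpha>) < 0 \<longrightarrow> g ((x ^^ b) \<beta>) < 0 \<longrightarrow>
        (\<exists>n\<le>max a b. g ((x ^^ n) (\<alpha> + \<beta>)) < 0))"

lemma sign_convex_zero_iff:
  assumes "sign_convex x A g" "x ` A \<subseteq> A" "\<gamma> \<in> A"
  shows "g ((x ^^ n) \<gamma>) = 0 \<longleftrightarrow> g \<gamma> = 0"
  using assms by (induction n) (auto simp: sign_convex_def funpow_in)

lemma sign_convexD:
  assumes "sign_convex x A g" "\<alpha> \<in> A" "\<beta> \<in> A" "\<alpha> + \<beta> \<in> A" "g \<alpha> > 0" "g \<beta> > 0"
    "g ((x ^^ a) \<alpha>) < 0" "g ((x ^^ b) \<beta>) < 0"
  shows "\<exists>n\<le>max a b. g ((x ^^ n) (\<alpha> + \<beta>)) < 0"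
  using assms unfolding sign_convex_def by blast

text \<open>Along an orbit \<open>L\<close> runs through a rotation by \<open>\<zeta>\<close>, so
  the plane lemmas apply to its real part. Genericity makes the zero set of
  \<open>Re (L \<gamma>)\<close> that of \<open>L\<close>, and the latter is compatible with
  \<open>x\<close> because \<open>\<zeta>\<close> is nonzero.\<close>

lemma sign_convex_rotation:
  fixes L :: "'a::ab_group_add \<Rightarrow> complex"
  assumes x: "x ` A \<subseteq> A" and L: "additive L" "\<And>\<gamma>. \<gamma> \<in> A \<Longrightarrow> L (x \<gamma>) = \<zeta> * L \<gamma>"
    and \<zeta>: "cmod \<zeta> = 1" "\<zeta> \<noteq> 1"
    and generic: "\<And>\<gamma>. \<gamma> \<in> A \<Longrightarrow> Re (L \<gamma>) = 0 \<Longrightarrow> L \<gamma> = 0"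
  shows "sign_convex x A (\<lambda>\<gamma>. Re (L \<gamma>))"
proof -
  have pow: "L ((x ^^ n) \<gamma>) = \<zeta> ^ n * L \<gamma>" if "\<gamma> \<in> A" for n \<gamma>
    using that by (induction n) (auto simp: L funpow_in [OF x])
  have "\<zeta> \<noteq> 0" using \<zeta> by auto
  have "Re (L (x \<gamma>)) = 0 \<longleftrightarrow> Re (L \<gamma>) = 0" if \<gamma>: "\<gamma> \<in> A" for \<gamma>
  proof -
    have "x \<gamma> \<in> A" using \<gamma> x by auto
    then have "Re (L (x \<gamma>)) = 0 \<longleftrightarrow> L (x \<gamma>) = 0" "Re (L \<gamma>) = 0 \<longleftrightarrow> L \<gamma> = 0"
      using generic \<gamma> by (metis zero_complex.sel(1))+
    then show ?thesis using L(2) [OF \<gamma>] \<open>\<zeta> \<noteq> 0\<close> by simp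
  qed
  moreover have "\<exists>n. Re (L ((x ^^ n) \<gamma>)) * Re (L \<gamma>) < 0" if \<gamma>: "\<gamma> \<in> A" "Re (L \<gamma>) \<noteq> 0" for \<gamma>
  proof (cases "Re (L \<gamma>) > 0")
    case True
    then obtain n where "Re (\<zeta> ^ n * L \<gamma>) < 0" using rotate_exit \<zeta> by blast
    then have "Re (L ((x ^^ n) \<gamma>)) * Re (L \<gamma>) < 0" unfolding pow [OF \<gamma>(1)] using True by (simp only: mult_neg_pos)
    then show ?thesis ..
  next
    case False
    then have "Re (- L \<gamma>) > 0" using \<gamma> by simp
    then obtain n where "Re (\<zeta> ^ n * (- L \<gamma>)) < 0" using rotate_exit \<zeta> by blast
    then have "Re (\<zeta> ^ n * L \<gamma>) > 0" by (simp only: mult_minus_right uminus_complex.sel neg_less_0_iff_less)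
    then have "Re (L ((x ^^ n) \<gamma>)) * Re (L \<gamma>) < 0" unfolding pow [OF \<gamma>(1)] using False \<gamma>
      by (intro mult_pos_neg) auto
    then show ?thesis ..
  qed
  moreover have "\<exists>n\<le>max a b. Re (L ((x ^^ n) (\<alpha> + \<beta>))) < 0"
    if "\<alpha> \<in> A" "\<beta> \<in> A" "\<alpha> + \<beta> \<in> A" "Re (L \<alpha>) > 0" "Re (L \<beta>) > 0"
      "Re (L ((x ^^ a) \<alpha>)) < 0" "Re (L ((x ^^ b) \<beta>)) < 0" for \<alpha> \<beta> a b
    using that rotate_sum_exit [OF \<zeta>, of "L \<alpha>" "L \<beta>" a b] additive.add [OF L(1), of \<alpha> \<beta>]
    by (simp only: pow)
  ultimately show ?thesis unfolding sign_convex_def by blast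
qed

text \<open>Here \<open>f\<close> has the signs of the lexicographic pair \<open>(g, h)\<close>.
  Vanishing of \<open>g\<close> is constant along orbits. If \<open>g\<close> vanishes at just one
  summand, the sum has the same \<open>g\<close>-values along its orbit as the other summand and
  leaves with it; if at both, only \<open>h\<close> decides.\<close>

lemma sign_convex_combine:
  assumes x: "x ` A \<subseteq> A" "additive x" and g: "additive g" "sign_convex x A g"
    and h: "additive h" "sign_convex x A h"
    and sg: "\<And>\<gamma>. \<gamma> \<in> A \<Longrightarrow> g \<gamma> \<noteq> 0 \<Longrightarrow> sgn (f \<gamma>) = sgn (g \<gamma>)"
    and sh: "\<And>\<gamma>. \<gamma> \<in> A \<Longrightarrow> g \<gamma> = 0 \<Longrightarrow> sgn (f \<gamma>) = sgn (h \<gamma>)"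
  shows "sign_convex x A f"
proof -
  note in_A = funpow_in [OF x(1)]
  note gz = sign_convex_zero_iff [OF g(2) x(1)] and hz = sign_convex_zero_iff [OF h(2) x(1)]
  have fz: "f \<gamma> = 0 \<longleftrightarrow> g \<gamma> = 0 \<and> h \<gamma> = 0" if "\<gamma> \<in> A" for \<gamma>
    using sg [OF that] sh [OF that] by (metis sgn_0_0)
  have neg: "f \<gamma> < 0 \<longleftrightarrow> g \<gamma> < 0 \<or> g \<gamma> = 0 \<and> h \<gamma> < 0" if "\<gamma> \<in> A" for \<gamma>
    using sg [OF that] sh [OF that] by (metis less_irrefl sgn_less)
  have pos: "f \<gamma> > 0 \<longleftrightarrow> g \<gamma> > 0 \<or> g \<gamma> = 0 \<and> h \<gamma> > 0" if "\<gamma> \<in> A" for \<gamma>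
    using sg [OF that] sh [OF that] by (metis less_irrefl sgn_greater)
  have "f (x \<gamma>) = 0 \<longleftrightarrow> f \<gamma> = 0" if \<gamma>: "\<gamma> \<in> A" for \<gamma>
    using fz [OF \<gamma>] fz [OF in_A [OF \<gamma>, of 1]] gz [OF \<gamma>, of 1] hz [OF \<gamma>, of 1] by simp
  moreover have "\<exists>n. f ((x ^^ n) \<gamma>) * f \<gamma> < 0" if \<gamma>: "\<gamma> \<in> A" "f \<gamma> \<noteq> 0" for \<gamma>
  proof (cases "g \<gamma> = 0")
    case True
    then obtain n where "h ((x ^^ n) \<gamma>) * h \<gamma> < 0"
      using h(2) \<gamma> fz by (auto simp: sign_convex_def)
    then have "f ((x ^^ n) \<gamma>) * f \<gamma> < 0"
      using True gz [OF \<gamma>(1)] by (auto simp: mult_less_0_iff neg pos \<gamma> in_A)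
    then show ?thesis ..
  next
    case False
    then obtain n where "g ((x ^^ n) \<gamma>) * g \<gamma> < 0"
      using g(2) \<gamma> fz by (auto simp: sign_convex_def)
    then have "f ((x ^^ n) \<gamma>) * f \<gamma> < 0"
      by (auto simp: mult_less_0_iff neg pos \<gamma> in_A)
    then show ?thesis ..
  qed
  moreover have "\<exists>n\<le>max a b. f ((x ^^ n) (\<alpha> + \<beta>)) < 0"
    if A: "\<alpha> \<in> A" "\<beta> \<in> A" "\<alpha> + \<beta> \<in> A" and f: "f \<alpha> > 0" "f \<beta> > 0"
      "f ((x ^^ a) \<alpha>) < 0" "f ((x ^^ b) \<beta>) < 0" for \<alpha> \<beta> a b
  proof -
    have gadd: "g ((x ^^ n) (\<alpha> + \<beta>)) = g ((x ^^ n) \<alpha>) + g ((x ^^ n) \<beta>)" for n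
      using additive.add [OF additive_funpow [OF x(2)]] additive.add [OF g(1)] by metis
    consider "g \<alpha> > 0" "g \<beta> > 0" | "g \<alpha> > 0" "g \<beta> = 0" | "g \<alpha> = 0" "g \<beta> > 0" | "g \<alpha> = 0" "g \<beta> = 0"
      using f A pos by blast
    then show ?thesis
    proof cases
      case 1
      then have "g ((x ^^ a) \<alpha>) < 0" "g ((x ^^ b) \<beta>) < 0"
        using f neg gz A in_A by (metis less_irrefl)+
      then obtain n where "n \<le> max a b" "g ((x ^^ n) (\<alpha> + \<beta>)) < 0"
        using 1 g(2) A unfolding sign_convex_def by blast
      then show ?thesis using neg A in_A by blast
    next
      case 2
      then have "g ((x ^^ a) \<alpha>) < 0" "g ((x ^^ a) \<beta>) = 0"
        using f neg gz A in_A by (metis less_irrefl)+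
      then show ?thesis using neg A in_A gadd by (intro exI [of _ a]) auto
    next
      case 3
      then have "g ((x ^^ b) \<beta>) < 0" "g ((x ^^ b) \<alpha>) = 0"
        using f neg gz A in_A by (metis less_irrefl)+
      then show ?thesis using neg A in_A gadd by (intro exI [of _ b]) auto
    next
      case 4
      then have "h \<alpha> > 0" "h \<beta> > 0" using pos f A by auto
      moreover have "g ((x ^^ n) \<alpha>) = 0" "g ((x ^^ n) \<beta>) = 0" for n
        using 4 gz A by auto
      moreover from this have "h ((x ^^ a) \<alpha>) < 0" "h ((x ^^ b) \<beta>) < 0"
        using f neg A in_A by force+
      ultimately obtain n where "n \<le> max a b" "h ((x ^^ n) (\<alpha> + \<beta>)) < 0"
        using h(2) A unfolding sign_convex_def by blast
      then show ?thesis using neg A in_A gadd \<open>\<And>n. g ((x ^^ n) \<alpha>) = 0\<close> \<open>\<And>n. g ((x ^^ n) \<beta>) = 0\<close>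
        by (intro exI [of _ n]) auto
    qed
  qed
  ultimately show ?thesis unfolding sign_convex_def by blast
qed

lemma funpow_conj:
  fixes x :: "'a \<Rightarrow> 'a"
  assumes "bij u"
  shows "u (((inv u \<circ> x \<circ> u) ^^ n) a) = (x ^^ n) (u a)"
  using assms by (induction n) (auto simp: bij_is_surj surj_f_inv_f)

lemma sign_convex_conj:
  assumes "bij u" "additive u" "u ` A \<subseteq> A" "sign_convex x A g"
  shows "sign_convex (inv u \<circ> x \<circ> u) A (g \<circ> u)"
proof -
  note pow = funpow_conj [OF assms(1), where x = x]
  have A: "u a \<in> A" if "a \<in> A" for a using that assms(3) by auto
  have "(g \<circ> u) ((inv u \<circ> x \<circ> u) \<gamma>) = 0 \<longleftrightarrow> (g \<circ> u) \<gamma> = 0" if "\<gamma> \<in> A" for \<gamma>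
    using pow [of 1 \<gamma>] A [OF that] assms(4) by (simp add: sign_convex_def)
  moreover have "\<exists>n. (g \<circ> u) (((inv u \<circ> x \<circ> u) ^^ n) \<gamma>) * (g \<circ> u) \<gamma> < 0"
    if "\<gamma> \<in> A" "(g \<circ> u) \<gamma> \<noteq> 0" for \<gamma>
    using A [OF that(1)] that assms(4) by (simp add: sign_convex_def pow)
  moreover have "\<exists>n\<le>max a b. (g \<circ> u) (((inv u \<circ> x \<circ> u) ^^ n) (\<alpha> + \<beta>)) < 0"
    if "\<alpha> \<in> A" "\<beta> \<in> A" "\<alpha> + \<beta> \<in> A" "(g \<circ> u) \<alpha> > 0" "(g \<circ> u) \<beta> > 0"
      "(g \<circ> u) (((inv u \<circ> x \<circ> u) ^^ a) \<alpha>) < 0" "(g \<circ> u) (((inv u \<circ> x \<circ> u) ^^ b) \<beta>) < 0" for \<alpha> \<beta> a b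
    using that A [OF that(1)] A [OF that(2)] A [OF that(3)] assms(4)
    unfolding comp_apply pow additive.add [OF assms(2)] sign_convex_def
    by blast
  ultimately show ?thesis unfolding sign_convex_def by blast
qed

section \<open>Separating functionals\<close>

lemma finite_common_period:
  assumes "finite A" "inj x" "x ` A \<subseteq> A"
  obtains d where "d > 0" "\<And>a. a \<in> A \<Longrightarrow> (x ^^ d) a = a"
proof -
  have "\<exists>n>0. (x ^^ n) a = a" if "a \<in> A" for a
  proof -
    have "{y. \<exists>n. y = (x ^^ n) a} \<subseteq> A" using funpow_in [OF assms(3) that] by auto
    then show ?thesis using funpow_inj_finite [OF assms(2)] assms(1) by (metis finite_subset)
  qed
  then obtain n where n: "\<And>a. a \<in> A \<Longrightarrow> n a > 0 \<and> (x ^^ n a) a = a" by metis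
  have "(x ^^ prod n A) a = a" if a: "a \<in> A" for a
  proof -
    have fix_pow: "(f ^^ k) a = a" if "f a = a" for f and k :: nat
      using that by (induction k) auto
    \<comment> \<open>The product of chosen periods of all points is a multiple of each of
      them.\<close>
    have "prod n A = n a * prod n (A - {a})" using assms(1) a by (rule prod.remove)
    then show ?thesis using n [OF a] fix_pow [of "x ^^ n a"] by (simp add: funpow_mult mult.commute [of "n a"])
  qed
  moreover have "prod n A > 0" using n by (simp add: prod_pos)
  ultimately show ?thesis using that by blast
qed

text \<open>Points are added one at a time: a small multiple of a functional nonzero at the new
  point \<open>b\<close> repairs a possible zero there without destroying the nonzero values
  elsewhere.\<close>

lemma additive_generic:
  fixes A :: "'a::ab_group_add set"
  assumes "finite A" "\<And>a. a \<in> A \<Longrightarrow> \<exists>q :: 'a \<Rightarrow> real. additive q \<and> q a \<noteq> 0"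
  shows "\<exists>q :: 'a \<Rightarrow> real. additive q \<and> (\<forall>a\<in>A. q a \<noteq> 0)"
  using assms
proof induction
  case empty
  have "additive (\<lambda>_::'a. 0::real)" by (simp add: additive_def)
  then show ?case by blast
next
  case (insert b A)
  then have "\<exists>q :: 'a \<Rightarrow> real. additive q \<and> (\<forall>a\<in>A. q a \<noteq> 0)" by simp
  then obtain q where q: "additive q" "\<And>a. a \<in> A \<Longrightarrow> q a \<noteq> (0::real)" by blast
  obtain r where r: "additive r" "r b \<noteq> (0::real)" using insert.prems [of b] by auto
  obtain e where e: "e > 0" "\<And>a. a \<in> insert b A \<Longrightarrow> q a \<noteq> 0 \<Longrightarrow> sgn (q a + e * r a) = sgn (q a)"
    using perturb_sign [of "insert b A" q r] insert.hyps(1) by auto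
  have "additive (\<lambda>a. q a + e * r a)"
    using q r by (simp add: additive_def algebra_simps)
  moreover have "q a + e * r a \<noteq> 0" if "a \<in> insert b A" for a
  proof (cases "q a = 0")
    case True
    then have "a = b" using q(2) that by blast
    then show ?thesis using True e(1) r(2) by simp
  next
    case False
    then show ?thesis using e(2) [OF that] by (metis sgn_0_0)
  qed
  ultimately show ?case by blast
qed

section \<open>Discrete Fourier components along orbits\<close>

lemma root_of_unity_neq_1:
  assumes "0 < k" "k < d"
  shows "cis (2 * pi / real d) ^ k \<noteq> 1"
proof
  assume "cis (2 * pi / real d) ^ k = 1"
  then have "cis (2 * pi * real k / real d) = cis (2 * pi * real 0 / real d)"
    by (simp add: DeMoivre mult.commute)
  moreover have "inj_on (\<lambda>k. cis (2 * pi * real k / real d)) {..<d}"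
    using bij_betw_roots_unity [of d] assms by (simp add: bij_betw_def)
  ultimately show False using assms inj_onD [of _ "{..<d}" k 0] by force
qed

text \<open>Unnormalized \<open>k\<close>-th Fourier coefficient of the sequence of values of
  \<open>l\<close> along the orbit of \<open>a\<close>, to be used when \<open>x ^^ d\<close> fixes
  \<open>a\<close>. As a function of \<open>a\<close> it is an eigenvector for composition with
  \<open>x\<close>.\<close>

definition fourier :: "('a \<Rightarrow> 'a) \<Rightarrow> ('a \<Rightarrow> real) \<Rightarrow> nat \<Rightarrow> nat \<Rightarrow> 'a \<Rightarrow> complex" where
  "fourier x l d k a = (\<Sum>j<d. cis (2 * pi / real d) ^ (j * k) * of_real (l ((x ^^ j) a)))"

lemma fourier_additive: "additive x \<Longrightarrow> additive l \<Longrightarrow> additive (fourier x l d k)"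
  using additive_funpow [of x]
  by (simp add: additive_def fourier_def algebra_simps sum.distrib)

text \<open>Passing from \<open>a\<close> to \<open>x a\<close> shifts the sequence by one place.
  The extra root of unity realigns the summands, and periodicity identifies the term
  \<open>?F d\<close> that enters with the term \<open>?F 0\<close> that drops out.\<close>

lemma fourier_shift:
  assumes "(x ^^ d) a = a"
  shows "cis (2 * pi / real d) ^ k * fourier x l d k (x a) = fourier x l d k a"
proof (cases "d = 0")
  case True
  then show ?thesis by (simp add: fourier_def)
next
  case False
  let ?F = "\<lambda>j. cis (2 * pi / real d) ^ (j * k) * complex_of_real (l ((x ^^ j) a))"
  have "cis (2 * pi / real d) ^ (d * k) = 1"
    using False by (simp add: power_mult DeMoivre)
  then have F: "?F d = ?F 0" using assms by simp
  have "cis (2 * pi / real d) ^ k * fourier x l d k (x a) = (\<Sum>j<d. ?F (Suc j))"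
    by (simp add: fourier_def sum_distrib_left power_add funpow_swap1 mult.assoc)
  also have "\<dots> = (\<Sum>j<d. ?F j)"
    using sum.lessThan_Suc_shift [of ?F d] F by simp
  finally show ?thesis by (simp add: fourier_def)
qed

text \<open>Summing over \<open>k\<close> first gives geometric sums over powers of a root of unity;
  these vanish unless \<open>j = 0\<close>. Thus the components together determine
  \<open>l\<close>.\<close>

lemma fourier_inversion:
  assumes "d > 0"
  shows "(\<Sum>k<d. fourier x l d k a) = of_nat d * of_real (l a)"
proof -
  let ?w = "cis (2 * pi / real d)"
  have geo: "(\<Sum>k<d. ?w ^ (j * k)) = (if j = 0 then of_nat d else 0)" if "j < d" for j
  proof (cases "j = 0")
    case False
    then have "?w ^ j \<noteq> 1" using root_of_unity_neq_1 that by simp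
    moreover have "(?w ^ j) ^ d = 1"
    proof -
      have "?w ^ d = 1" using assms by (simp add: DeMoivre)
      then show ?thesis by (simp flip: power_mult add: mult.commute [of j]) (simp add: power_mult)
    qed
    ultimately show ?thesis using False by (simp add: power_mult geometric_sum)
  qed simp
  have "(\<Sum>k<d. fourier x l d k a) = (\<Sum>j<d. (\<Sum>k<d. ?w ^ (j * k)) * of_real (l ((x ^^ j) a)))"
    unfolding fourier_def by (subst sum.swap) (simp add: sum_distrib_right)
  also have "\<dots> = (\<Sum>j<d. if j = 0 then of_nat d * of_real (l a) else 0)"
    by (rule sum.cong) (auto simp: geo)
  finally show ?thesis using assms by simp
qed

text \<open>Induction over the components: each new one enters through its real part, slightly
  rotated to be generic, with a weight too small to alter the nonzero signs obtained so far.\<close>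

lemma exists_sign_convex_rotations:
  fixes x :: "'a::ab_group_add \<Rightarrow> 'a" and L :: "'k \<Rightarrow> 'a \<Rightarrow> complex"
  assumes A: "finite A" and x: "bij x" "additive x" "x ` A = A" and K: "finite K"
    and L: "\<And>k. k \<in> K \<Longrightarrow> additive (L k)"
      "\<And>k \<gamma>. k \<in> K \<Longrightarrow> \<gamma> \<in> A \<Longrightarrow> L k (x \<gamma>) = \<zeta> k * L k \<gamma>"
    and \<zeta>: "\<And>k. k \<in> K \<Longrightarrow> cmod (\<zeta> k) = 1 \<and> \<zeta> k \<noteq> 1"
  shows "\<exists>g. additive g \<and> sign_convex x A g \<and> sign_convex (inv x) A g \<and>
    (\<forall>\<gamma>\<in>A. g \<gamma> = 0 \<longleftrightarrow> (\<forall>k\<in>K. L k \<gamma> = 0))"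
  using K L \<zeta>
proof induction
  case empty
  show ?case by (rule exI [of _ "\<lambda>_. 0"]) (auto simp: additive_def sign_convex_def)
next
  case (insert k K)
  have "\<exists>g. additive g \<and> sign_convex x A g \<and> sign_convex (inv x) A g \<and>
    (\<forall>\<gamma>\<in>A. g \<gamma> = 0 \<longleftrightarrow> (\<forall>k\<in>K. L k \<gamma> = 0))"
    by (intro insert.IH insert.prems; simp)
  then obtain g where g: "additive g" "sign_convex x A g" "sign_convex (inv x) A g"
    "\<And>\<gamma>. \<gamma> \<in> A \<Longrightarrow> g \<gamma> = 0 \<longleftrightarrow> (\<forall>k\<in>K. L k \<gamma> = 0)"
    by blast
  have ix: "inv x ` A = A" "additive (inv x)"
    using image_inv_eq additive_inv x by blast+
  \<comment> \<open>Multiplication by \<open>Complex 1 c\<close> turns the real part into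
    \<open>Re - c * Im\<close>. With \<open>c\<close> this small, it vanishes on \<open>A\<close>
    only where both parts do.\<close>
  obtain c where c: "c > 0"
    "\<And>\<gamma>. \<gamma> \<in> A \<Longrightarrow> Re (L k \<gamma>) \<noteq> 0 \<Longrightarrow> sgn (Re (L k \<gamma>) + c * - Im (L k \<gamma>)) = sgn (Re (L k \<gamma>))"
    using perturb_sign [OF A, of "\<lambda>\<gamma>. Re (L k \<gamma>)" "\<lambda>\<gamma>. - Im (L k \<gamma>)"] by blast
  define M where "M = (\<lambda>\<gamma>. Complex 1 c * L k \<gamma>)"
  have M0: "M \<gamma> = 0 \<longleftrightarrow> L k \<gamma> = 0" for \<gamma> 
  proof -
    have "Complex 1 c \<noteq> 0" by (simp add: complex_eq_iff)
    then show ?thesis by (simp add: M_def)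
  qed
  have generic: "M \<gamma> = 0" if \<gamma>: "\<gamma> \<in> A" "Re (M \<gamma>) = 0" for \<gamma>
  proof -
    have re: "Re (L k \<gamma>) + c * - Im (L k \<gamma>) = 0" using \<gamma>(2) by (simp add: M_def)
    then have "Re (L k \<gamma>) = 0" using c(2) [OF \<gamma>(1)] by (metis sgn_0_0 sgn_0)
    then have "L k \<gamma> = 0" using re c(1) by (simp add: complex_eq_iff)
    then show ?thesis by (simp only: M0)
  qed
  have M: "additive M" using insert.prems(1) [of k] by (simp add: additive_def M_def algebra_simps)
  have Mx: "M (x \<gamma>) = \<zeta> k * M \<gamma>" if "\<gamma> \<in> A" for \<gamma>
    using insert.prems(2) [of k \<gamma>] that by (simp add: M_def)
  have zk: "cmod (\<zeta> k) = 1" "\<zeta> k \<noteq> 1" using insert.prems(3) by auto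
  then have "\<zeta> k \<noteq> 0" by auto
  \<comment> \<open>The inverse eigenvalue is again of modulus 1 and different from 1, so the same
    \<open>M\<close> serves \<open>inv x\<close>.\<close>
  have Mix: "M (inv x \<gamma>) = inverse (\<zeta> k) * M \<gamma>" if "\<gamma> \<in> A" for \<gamma>
  proof -
    have "inv x \<gamma> \<in> A" using ix that by auto
    then show ?thesis using Mx [of "inv x \<gamma>"] x \<open>\<zeta> k \<noteq> 0\<close> by (simp add: bij_is_surj surj_f_inv_f)
  qed
  let ?h = "\<lambda>\<gamma>. Re (M \<gamma>)"
  have h: "sign_convex x A ?h"
    using x(3) by (intro sign_convex_rotation [OF _ M Mx zk generic]) auto
  have hi: "sign_convex (inv x) A ?h"
    using ix(1) zk by (intro sign_convex_rotation [OF _ M Mix _ _ generic]) (auto simp: norm_inverse)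
  have ha: "additive ?h" using M by (simp add: additive_def)
  obtain e where e: "e > 0" "\<And>\<gamma>. \<gamma> \<in> A \<Longrightarrow> g \<gamma> \<noteq> 0 \<Longrightarrow> sgn (g \<gamma> + e * ?h \<gamma>) = sgn (g \<gamma>)"
    using perturb_sign [OF A, of g ?h] by blast
  let ?f = "\<lambda>\<gamma>. g \<gamma> + e * ?h \<gamma>"
  have sh: "sgn (?f \<gamma>) = sgn (?h \<gamma>)" if "g \<gamma> = 0" for \<gamma>
    using that e(1) by (simp add: sgn_mult)
  have fz: "?f \<gamma> = 0 \<longleftrightarrow> g \<gamma> = 0 \<and> L k \<gamma> = 0" if "\<gamma> \<in> A" for \<gamma>
  proof -
    have "?h \<gamma> = 0 \<longleftrightarrow> L k \<gamma> = 0" using generic [OF that] M0 [of \<gamma>] by (metis zero_complex.sel(1))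
    then show ?thesis using e(1) e(2) [OF that] by (cases "g \<gamma> = 0") (auto simp: sgn_0_0)
  qed
  have "additive ?f" using g(1) ha by (simp add: additive_def algebra_simps)
  moreover have "sign_convex x A ?f"
    by (rule sign_convex_combine [OF _ x(2) g(1,2) ha h e(2) sh]) (use x in auto)
  moreover have "sign_convex (inv x) A ?f"
    by (rule sign_convex_combine [OF _ ix(2) g(1,3) ha hi e(2) sh]) (use ix in auto)
  ultimately show ?case using fz g(4) by (intro exI [of _ ?f]) auto
qed


text \<open>The component with \<open>k = 0\<close> has eigenvalue 1 and is left out. The remaining
  ones vanish together at a point of \<open>A\<close> exactly when \<open>x\<close> fixes it, since
  \<open>l\<close> distinguishes moved points from their images.\<close>

lemma exists_sign_convex_functional:
  fixes x :: "'a::ab_group_add \<Rightarrow> 'a" and l :: "'a \<Rightarrow> real"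
  assumes A: "finite A" and x: "bij x" "additive x" "x ` A = A"
    and l: "additive l" "\<And>\<gamma>. \<gamma> \<in> A \<Longrightarrow> x \<gamma> \<noteq> \<gamma> \<Longrightarrow> l (x \<gamma>) \<noteq> l \<gamma>"
  shows "\<exists>g. additive g \<and> sign_convex x A g \<and> sign_convex (inv x) A g \<and>
    (\<forall>\<gamma>\<in>A. g \<gamma> = 0 \<longleftrightarrow> x \<gamma> = \<gamma>)"
proof -
  obtain d where d: "d > 0" "\<And>a. a \<in> A \<Longrightarrow> (x ^^ d) a = a"
    using finite_common_period [OF A bij_is_inj [OF x(1)]] x(3) by blast
  let ?L = "fourier x l d"
  define \<zeta> where "\<zeta> k = inverse (cis (2 * pi / real d) ^ k)" for k
  have Lx: "?L k (x \<gamma>) = \<zeta> k * ?L k \<gamma>" if "\<gamma> \<in> A" for k \<gamma>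
  proof -
    have "\<zeta> k * ?L k \<gamma> = (\<zeta> k * cis (2 * pi / real d) ^ k) * ?L k (x \<gamma>)"
      unfolding fourier_shift [OF d(2) [OF that], of k l, symmetric] by (simp only: mult.assoc)
    then show ?thesis by (simp add: \<zeta>_def)
  qed
  have \<zeta>: "cmod (\<zeta> k) = 1 \<and> \<zeta> k \<noteq> 1" if "k \<in> {1..<d}" for k
  proof
    show "cmod (\<zeta> k) = 1" by (simp add: \<zeta>_def norm_inverse norm_power)
    show "\<zeta> k \<noteq> 1" using root_of_unity_neq_1 [of k d] that by (simp add: \<zeta>_def inverse_eq_1_iff)
  qed
  have fixed: "(\<forall>k\<in>{1..<d}. ?L k \<gamma> = 0) \<longleftrightarrow> x \<gamma> = \<gamma>" if \<gamma>: "\<gamma> \<in> A" for \<gamma>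
  proof
    assume z: "\<forall>k\<in>{1..<d}. ?L k \<gamma> = 0"
    \<comment> \<open>The component \<open>k = 0\<close> is \<open>x\<close>-invariant and the
      others are zero at \<open>\<gamma>\<close>, hence at \<open>x \<gamma>\<close>; inversion then
      compares the values of \<open>l\<close>.\<close>
    have "(\<Sum>k<d. ?L k (x \<gamma>)) = (\<Sum>k<d. ?L k \<gamma>)"
    proof (rule sum.cong)
      fix k assume "k \<in> {..<d}"
      then show "?L k (x \<gamma>) = ?L k \<gamma>"
        using z Lx [OF \<gamma>, of k] by (cases "k = 0") (auto simp: \<zeta>_def)
    qed simp
    then have "l (x \<gamma>) = l \<gamma>" using d(1) by (simp add: fourier_inversion)
    then show "x \<gamma> = \<gamma>" using l(2) \<gamma> by blast
  next
    assume f: "x \<gamma> = \<gamma>"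
    show "\<forall>k\<in>{1..<d}. ?L k \<gamma> = 0"
    proof
      fix k assume "k \<in> {1..<d}"
      then have "\<zeta> k \<noteq> 1" using \<zeta> by blast
      then show "?L k \<gamma> = 0" using Lx [OF \<gamma>, of k] f by simp
    qed
  qed
  have "\<exists>g. additive g \<and> sign_convex x A g \<and> sign_convex (inv x) A g \<and>
      (\<forall>\<gamma>\<in>A. g \<gamma> = 0 \<longleftrightarrow> (\<forall>k\<in>{1..<d}. ?L k \<gamma> = 0))"
    by (rule exists_sign_convex_rotations [OF A x _ _ _ \<zeta>])
      (auto intro: fourier_additive [OF x(2) l(1)] Lx)
  then show ?thesis using fixed by auto
qed

section \<open>Root data\<close>

lemma additive_int_scale:
  assumes "additive f"
  shows "f (int_scale n a) = int_scale n (f a)"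
proof -
  interpret additive f by fact
  have "f ((((+) a) ^^ m) 0) = (((+) (f a)) ^^ m) 0" for m
    by (induction m) (auto simp: add zero)
  then show ?thesis by (simp add: int_scale_def diff)
qed

lemma int_scale_eq_mult:
  fixes r :: "'b::ring_1"
  shows "int_scale n r = of_int n * r"
proof -
  have "(((+) r) ^^ m) 0 = of_nat m * r" for m
    by (induction m) (auto simp: algebra_simps)
  then show ?thesis by (cases n rule: int_cases2) (auto simp: int_scale_def)
qed

context
  fixes p :: "'x::ab_group_add \<Rightarrow> 'y::ab_group_add \<Rightarrow> int" and R :: "'x set" and c :: "'x \<Rightarrow> 'y"
  assumes datum: "root_datum p R c"
begin

lemma pairing_additive_left: "additive (\<lambda>a. p a b)"
proof -
  have "bij_betw (\<lambda>b a. p a b) UNIV {f. additive f}"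
    using datum by (simp add: root_datum_def perfect_pairing_def)
  from bij_betwE [OF this] show ?thesis by simp
qed

lemma pairing_nondegenerate:
  assumes "a \<noteq> 0"
  shows "\<exists>b. p a b \<noteq> 0"
proof (rule ccontr)
  assume "\<not> ?thesis"
  then have "p a = p 0" by (auto simp: additive.zero [OF pairing_additive_left])
  moreover have "inj p"
    using datum unfolding root_datum_def perfect_pairing_def bij_betw_def by simp
  ultimately show False using assms by (simp add: inj_eq)
qed

lemma finite_roots: "finite R"
  using datum by (simp add: root_datum_def)

lemma pairing_coroot_self: "\<alpha> \<in> R \<Longrightarrow> p \<alpha> (c \<alpha>) = 2"
  using datum by (simp add: root_datum_def)

lemma reflection_additive: "additive (reflection p c \<alpha>)"
  by standard
    (simp add: reflection_def additive.add [OF pairing_additive_left] int_scale_add_left)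

lemma additive_reflection:
  assumes "additive f"
  shows "f (reflection p c \<alpha> a) = f a - int_scale (p a (c \<alpha>)) (f \<alpha>)"
  by (simp add: reflection_def additive.diff [OF assms] additive_int_scale [OF assms])

lemma pairing_reflection:
  assumes "\<alpha> \<in> R"
  shows "p (reflection p c \<alpha> a) (c \<alpha>) = - p a (c \<alpha>)"
  using additive_reflection [OF pairing_additive_left [of "c \<alpha>"], of \<alpha> a] pairing_coroot_self [OF assms]
  by (simp add: int_scale_eq_mult)

lemma reflection_self: "\<alpha> \<in> R \<Longrightarrow> reflection p c \<alpha> \<alpha> = - \<alpha>"
  using int_scale_add_left [of 1 1 \<alpha>] by (simp add: reflection_def pairing_coroot_self)

lemma reflection_involution:
  assumes "\<alpha> \<in> R"
  shows "reflection p c \<alpha> (reflection p c \<alpha> a) = a"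
  unfolding reflection_def [of p c \<alpha> "reflection p c \<alpha> a"] pairing_reflection [OF assms]
  by (simp add: reflection_def int_scale_minus)

lemma reflection_inv:
  assumes "\<alpha> \<in> R"
  shows "bij (reflection p c \<alpha>)" "inv (reflection p c \<alpha>) = reflection p c \<alpha>"
proof -
  have s: "reflection p c \<alpha> \<circ> reflection p c \<alpha> = id"
    by (rule ext) (simp add: reflection_involution [OF assms])
  show "bij (reflection p c \<alpha>)" by (rule o_bij [OF s s])
  show "inv (reflection p c \<alpha>) = reflection p c \<alpha>" by (rule inv_unique_comp [OF s s])
qed

lemma reflection_roots: "\<alpha> \<in> R \<Longrightarrow> reflection p c \<alpha> ` R = R"
  using datum by (simp add: root_datum_def)

lemma root_nonzero: "\<alpha> \<in> R \<Longrightarrow> \<alpha> \<noteq> 0"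
  using pairing_coroot_self [of \<alpha>] additive.zero [OF pairing_additive_left] by force

lemma uminus_root:
  assumes "\<alpha> \<in> R"
  shows "- \<alpha> \<in> R"
  using reflection_roots [OF assms] reflection_self [OF assms] assms by (metis imageI)

section \<open>The Weyl group on the character lattice and its chambers\<close>

lemma weyl_group_props:
  assumes "w \<in> weyl_group p R c"
  shows "bij w" "additive w" "w ` R = R"
proof -
  from assms have "bij w \<and> additive w \<and> w ` R = R"
  proof induction
    case id
    show ?case by (simp add: additive_def flip: id_def)
  next
    case (refl \<alpha> w)
    then show ?case
      using additive_automorphism_comp [OF reflection_inv(1) reflection_additive reflection_roots, OF refl(1,1)]
      by blast
  qed
  then show "bij w" "additive w" "w ` R = R" by auto
qed

lemma weyl_group_comp:
  assumes "v \<in> weyl_group p R c" "w \<in> weyl_group p R c"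
  shows "v \<circ> w \<in> weyl_group p R c"
  using assms by induction (auto simp: comp_assoc intro: weyl_group.refl)

lemma reflection_in_weyl_group: "\<alpha> \<in> R \<Longrightarrow> reflection p c \<alpha> \<in> weyl_group p R c"
  using weyl_group.refl [OF _ weyl_group.id] by fastforce

lemma weyl_group_inv:
  assumes "w \<in> weyl_group p R c"
  shows "inv w \<in> weyl_group p R c"
  using assms
proof induction
  case id
  show ?case unfolding inv_id by (rule weyl_group.id)
next
  case (refl \<alpha> w)
  then have "inv (reflection p c \<alpha> \<circ> w) = inv w \<circ> reflection p c \<alpha>"
    using reflection_inv [of \<alpha>] weyl_group_props [of w] by (simp add: o_inv_distrib)
  moreover have "inv w \<circ> reflection p c \<alpha> \<in> weyl_group p R c"
    using refl weyl_group_comp reflection_in_weyl_group by blast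
  ultimately show ?case by (simp only:)
qed

text \<open>Reindexing by the reflection negates \<open>p \<gamma> (c \<alpha>)\<close> and
  subtracts \<open>p \<gamma> (c \<alpha>)\<close> times \<open>l \<alpha>\<close> from
  \<open>l \<gamma>\<close>. So the sum equals its own negative plus the right-hand side. It says
  that the invariant form pairs a coroot with \<open>l\<close> to a multiple of
  \<open>l \<alpha>\<close>.\<close>

lemma sum_pairing_coroot:
  assumes l: "additive l" and \<alpha>: "\<alpha> \<in> R"
  shows "2 * (\<Sum>\<gamma>\<in>R. of_int (p \<gamma> (c \<alpha>)) * l \<gamma>) = (\<Sum>\<gamma>\<in>R. (of_int (p \<gamma> (c \<alpha>)))\<^sup>2) * (l \<alpha> :: real)"
proof -
  let ?s = "reflection p c \<alpha>"
  have "inj_on ?s R" using reflection_inv [OF \<alpha>] by (meson bij_is_inj inj_on_subset subset_UNIV)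
  then have "(\<Sum>\<gamma>\<in>R. of_int (p \<gamma> (c \<alpha>)) * l \<gamma>) = (\<Sum>\<gamma>\<in>R. of_int (p (?s \<gamma>) (c \<alpha>)) * l (?s \<gamma>))"
    using sum.reindex [of ?s R "\<lambda>\<gamma>. of_int (p \<gamma> (c \<alpha>)) * l \<gamma>"] reflection_roots [OF \<alpha>] by simp
  also have "\<dots> = (\<Sum>\<gamma>\<in>R. (of_int (p \<gamma> (c \<alpha>)))\<^sup>2 * l \<alpha> - of_int (p \<gamma> (c \<alpha>)) * l \<gamma>)"
    by (simp add: pairing_reflection [OF \<alpha>] additive_reflection [OF l] int_scale_eq_mult
        power2_eq_square algebra_simps)
  finally show ?thesis by (simp add: sum_subtractf sum_distrib_right)
qed

text \<open>
  The form \<open>\<Sum>\<gamma>\<in>R. f \<gamma> * l \<gamma>\<close> on functionals is invariant under the Weyl group. A member of the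
  orbit of \<open>f\<close> that maximizes it cannot be improved by any reflection, so it lies in the
  closed chamber of \<open>l\<close>.
\<close>

lemma weyl_group_same_chamber:
  fixes f l :: "'x \<Rightarrow> real"
  assumes f: "additive f" and l: "additive l"
  obtains u where "u \<in> weyl_group p R c" "\<And>\<alpha>. \<alpha> \<in> R \<Longrightarrow> f (u \<alpha>) * l \<alpha> \<ge> 0"
proof -
  let ?W = "weyl_group p R c"
  define B where "B u = (\<Sum>\<gamma>\<in>R. f (u \<gamma>) * l \<gamma>)" for u
  \<comment> \<open>\<open>B u\<close> depends only on the restriction of \<open>u\<close> to the
    finite set \<open>R\<close>, so \<open>B\<close> takes finitely many values and a maximum
    exists.\<close>
  have "B ` ?W \<subseteq> B ` (R \<rightarrow>\<^sub>E R)"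
  proof
    fix b assume "b \<in> B ` ?W"
    then obtain u where u: "u \<in> ?W" "b = B u" by blast
    then have "restrict u R \<in> R \<rightarrow>\<^sub>E R" using weyl_group_props(3) [OF u(1)] by auto
    moreover have "B (restrict u R) = B u" by (simp add: B_def)
    ultimately show "b \<in> B ` (R \<rightarrow>\<^sub>E R)" using u(2) by (metis imageI)
  qed
  then have "finite (B ` ?W)"
    by (rule finite_subset) (intro finite_imageI finite_PiE finite_roots)
  moreover have "B ` ?W \<noteq> {}" using weyl_group.id by blast
  ultimately have "Max (B ` ?W) \<in> B ` ?W" by (rule Max_in)
  then obtain u where "u \<in> ?W" "B u = Max (B ` ?W)" by force
  with \<open>finite (B ` ?W)\<close> have u: "u \<in> ?W" "\<And>v. v \<in> ?W \<Longrightarrow> B v \<le> B u" by auto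
  have "f (u \<alpha>) * l \<alpha> \<ge> 0" if \<alpha>: "\<alpha> \<in> R" for \<alpha>
  proof -
    have fu: "additive (f \<circ> u)"
      using f weyl_group_props(2) [OF u(1)] by (simp add: additive_def)
    have "B (u \<circ> reflection p c \<alpha>) \<le> B u"
      using u weyl_group_comp reflection_in_weyl_group [OF \<alpha>] by blast
    moreover have "B (u \<circ> reflection p c \<alpha>) =
        B u - f (u \<alpha>) * (\<Sum>\<gamma>\<in>R. of_int (p \<gamma> (c \<alpha>)) * l \<gamma>)"
      using additive_reflection [OF fu, of \<alpha>]
      by (simp add: B_def int_scale_eq_mult left_diff_distrib sum_subtractf sum_distrib_left mult.assoc mult.left_commute)
    ultimately have "0 \<le> f (u \<alpha>) * (2 * (\<Sum>\<gamma>\<in>R. of_int (p \<gamma> (c \<alpha>)) * l \<gamma>))" by simp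
    then have "0 \<le> (f (u \<alpha>) * l \<alpha>) * (\<Sum>\<gamma>\<in>R. (of_int (p \<gamma> (c \<alpha>)))\<^sup>2)"
      unfolding sum_pairing_coroot [OF l \<alpha>] by (simp add: ac_simps)
    \<comment> \<open>The summand for \<open>\<alpha>\<close> itself is \<open>2\<^sup>2\<close>, so
      the common factor is positive and can be cancelled.\<close>
    moreover have "(\<Sum>\<gamma>\<in>R. (of_int (p \<gamma> (c \<alpha>)))\<^sup>2) > (0::real)"
      using finite_roots \<alpha> pairing_coroot_self [OF \<alpha>] by (intro sum_pos2 [of _ \<alpha>]) auto
    ultimately show ?thesis by (simp add: zero_le_mult_iff)
  qed
  then show ?thesis using that u(1) by blast
qed

lemma extended_weyl_group_props:
  assumes "based_automorphism p R c P \<delta>" "x \<in> extended_weyl_group p R c \<delta>"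
  shows "bij x" "additive x" "x ` R = R"
proof -
  have \<delta>: "bij \<delta>" "additive \<delta>" "\<delta> ` R = R"
    using assms(1) by (auto simp: based_automorphism_def)
  have pow: "bij (h ^^ n) \<and> additive (h ^^ n) \<and> (h ^^ n) ` R = R"
    if "bij h" "additive h" "h ` R = R" for h :: "'x \<Rightarrow> 'x" and n
  proof (induction n)
    case 0
    show ?case by (simp add: additive_def flip: id_def)
  next
    case (Suc n)
    then show ?case
      unfolding funpow.simps using additive_automorphism_comp [OF that, of "h ^^ n"] by blast
  qed
  have "bij (inv \<delta>)" "additive (inv \<delta>)" "inv \<delta> ` R = R"
    using \<delta> bij_imp_bij_inv additive_inv image_inv_eq by blast+
  then have d: "bij (fun_pow_int \<delta> i) \<and> additive (fun_pow_int \<delta> i) \<and> fun_pow_int \<delta> i ` R = R" for i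
    using pow [of \<delta>] pow [of "inv \<delta>"] \<delta> by (simp add: fun_pow_int_def)
  obtain w i where w: "w \<in> weyl_group p R c" "x = w \<circ> fun_pow_int \<delta> i"
    using assms(2) by (auto simp: extended_weyl_group_def)
  show "bij x" "additive x" "x ` R = R"
    unfolding w(2) using additive_automorphism_comp [OF weyl_group_props [OF w(1)]] d [of i] by blast+
qed

end

section \<open>Convexity\<close>

lemma fun_pow_int_fixed:
  assumes "bij x" "x a = a"
  shows "fun_pow_int x i a = a"
proof -
  have "inv x a = a" using assms by (metis bij_is_inj inv_f_f)
  moreover have "(h ^^ n) a = a" if "h a = a" for h :: "'a \<Rightarrow> 'a" and n
    using that by (induction n) auto
  ultimately show ?thesis using assms(2) by (simp add: fun_pow_int_def)
qed

section \<open>Convexity for the positive system of a regular functional \<open>f\<close> refining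
  the signs of \<open>g\<close>\<close>

context
  fixes R P :: "'a::ab_group_add set" and f g :: "'a \<Rightarrow> real"
  assumes R: "finite R" "\<And>\<gamma>. \<gamma> \<in> R \<Longrightarrow> - \<gamma> \<in> R"
    and f: "additive f" "\<And>\<gamma>. \<gamma> \<in> R \<Longrightarrow> f \<gamma> \<noteq> 0"
    and P: "P = {\<gamma> \<in> R. f \<gamma> > 0}"
    and g: "additive g"
    and fg: "\<And>\<gamma>. \<gamma> \<in> R \<Longrightarrow> g \<gamma> \<noteq> 0 \<Longrightarrow> sgn (f \<gamma>) = sgn (g \<gamma>)"
begin

lemma uminus_image_positive: "uminus ` P = {\<gamma> \<in> R. f \<gamma> < 0}"
proof
  show "uminus ` P \<subseteq> {\<gamma> \<in> R. f \<gamma> < 0}"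
    using R(2) by (auto simp: P additive.minus [OF f(1)])
  show "{\<gamma> \<in> R. f \<gamma> < 0} \<subseteq> uminus ` P"
  proof
    fix \<gamma> assume "\<gamma> \<in> {\<gamma> \<in> R. f \<gamma> < 0}"
    then have "- \<gamma> \<in> P" using R(2) by (auto simp: P additive.minus [OF f(1)])
    then show "\<gamma> \<in> uminus ` P" by (metis add.inverse_inverse imageI)
  qed
qed

lemma negative_of_g: "\<gamma> \<in> R \<Longrightarrow> g \<gamma> < 0 \<Longrightarrow> f \<gamma> < 0"
  using fg [of \<gamma>] by (metis less_irrefl sgn_less)

lemma positive_of_g: "\<gamma> \<in> R \<Longrightarrow> g \<gamma> > 0 \<Longrightarrow> f \<gamma> > 0"
  using fg [of \<gamma>] by (metis less_irrefl sgn_greater)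

lemma g_nonneg: "\<gamma> \<in> P \<Longrightarrow> g \<gamma> \<ge> 0"
  using negative_of_g [of \<gamma>] by (fastforce simp: P)

text \<open>A moved root has nonzero \<open>g\<close>, and its orbit reaches a root with the
  opposite sign of \<open>g\<close>, hence of \<open>f\<close>. A fixed root keeps its sign because
  \<open>f\<close> is regular.\<close>

lemma stable_roots_eq_fixed:
  assumes x: "bij x" "x ` R = R" and sc: "sign_convex x R g"
    and gz: "\<And>\<gamma>. \<gamma> \<in> R \<Longrightarrow> g \<gamma> = 0 \<longleftrightarrow> x \<gamma> = \<gamma>"
  shows "stable_roots P x = fixed_roots R x"
proof
  show "fixed_roots R x \<subseteq> stable_roots P x"
  proof
    fix \<gamma> assume "\<gamma> \<in> fixed_roots R x"
    then have \<gamma>: "\<gamma> \<in> R" "x \<gamma> = \<gamma>" by (auto simp: fixed_roots_def)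
    then have "f \<gamma> > 0 \<or> f \<gamma> < 0" using f(2) by force
    then show "\<gamma> \<in> stable_roots P x"
      unfolding stable_roots_def roots_staying_in_def uminus_image_positive
      using \<gamma> by (auto simp: P fun_pow_int_fixed [OF x(1)])
  qed
  show "stable_roots P x \<subseteq> fixed_roots R x"
  proof
    fix \<gamma> assume s: "\<gamma> \<in> stable_roots P x"
    then have \<gamma>: "\<gamma> \<in> R"
      unfolding stable_roots_def roots_staying_in_def uminus_image_positive by (auto simp: P)
    have "x \<gamma> = \<gamma>"
    proof (rule ccontr)
      assume "x \<gamma> \<noteq> \<gamma>"
      then have gn: "g \<gamma> \<noteq> 0" using gz \<gamma> by blast
      then obtain n where n: "g ((x ^^ n) \<gamma>) * g \<gamma> < 0"
        using sc \<gamma> unfolding sign_convex_def by blast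
      have xn: "(x ^^ n) \<gamma> \<in> R" by (rule funpow_in [OF equalityD1 [OF x(2)] \<gamma>])
      have "(x ^^ n) \<gamma> = fun_pow_int x (int n) \<gamma>" by (simp add: fun_pow_int_def)
      then have "f ((x ^^ n) \<gamma>) * f \<gamma> > 0"
        using s unfolding stable_roots_def roots_staying_in_def uminus_image_positive
        by (auto simp: P mult_neg_neg)
      moreover have "f ((x ^^ n) \<gamma>) * f \<gamma> < 0"
        using n negative_of_g [OF xn] negative_of_g [OF \<gamma>] positive_of_g [OF xn] positive_of_g [OF \<gamma>]
        by (auto simp: mult_less_0_iff)
      ultimately show False by simp
    qed
    then show "\<gamma> \<in> fixed_roots R x" using \<gamma> by (simp add: fixed_roots_def)
  qed
qed

text \<open>
  The functional \<open>g\<close> vanishes exactly on the fixed roots and is nonnegative on positive roots,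
  so a decomposition of a fixed positive root into simple roots stays among the fixed roots.
\<close>

lemma fixed_roots_parabolic:
  assumes x: "additive x" and gz: "\<And>\<gamma>. \<gamma> \<in> R \<Longrightarrow> g \<gamma> = 0 \<longleftrightarrow> x \<gamma> = \<gamma>"
  shows "fixed_roots R x = R \<inter> int_span (simple_roots P \<inter> fixed_roots R x)"
proof -
  interpret module "int_scale :: int \<Rightarrow> 'a \<Rightarrow> 'a" by (rule module_int_scale)
  let ?J = "simple_roots P \<inter> fixed_roots R x"
  have pos: "\<gamma> \<in> span ?J" if "\<gamma> \<in> P" "x \<gamma> = \<gamma>" for \<gamma>
    using that
  \<comment> \<open>The values of \<open>f\<close> are real, so the induction counts the positive
    roots below \<open>\<gamma>\<close> instead of using the value itself.\<close>
  proof (induction "card {\<beta> \<in> P. f \<beta> < f \<gamma>}" arbitrary: \<gamma> rule: less_induct)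
    case less
    show ?case
    proof (cases "\<gamma> \<in> simple_roots P")
      case True
      then have "\<gamma> \<in> ?J" using less.prems by (auto simp: fixed_roots_def P)
      then show ?thesis by (rule span_base)
    next
      case False
      then obtain \<alpha> \<beta> where ab: "\<alpha> \<in> P" "\<beta> \<in> P" "\<gamma> = \<alpha> + \<beta>"
        using less.prems by (auto simp: simple_roots_def)
      have "g \<gamma> = 0" using gz less.prems by (auto simp: P)
      then have "g \<alpha> = 0" "g \<beta> = 0"
        using g_nonneg [OF ab(1)] g_nonneg [OF ab(2)] ab(3) additive.add [OF g, of \<alpha> \<beta>] by auto
      then have fixed: "x \<alpha> = \<alpha>" "x \<beta> = \<beta>" using gz ab by (auto simp: P)
      have fab: "f \<gamma> = f \<alpha> + f \<beta>" "f \<alpha> > 0" "f \<beta> > 0"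
        using ab additive.add [OF f(1)] by (auto simp: P)
      have smaller: "card {\<beta> \<in> P. f \<beta> < f \<epsilon>} < card {\<beta> \<in> P. f \<beta> < f \<gamma>}"
        if "\<epsilon> \<in> P" "f \<epsilon> < f \<gamma>" for \<epsilon>
        using that R(1) by (intro psubset_card_mono) (auto simp: P)
      show ?thesis
        unfolding ab(3) using less.hyps [OF smaller] fixed ab fab by (intro span_add) auto
    qed
  qed
  have "fixed_roots R x \<subseteq> R \<inter> span ?J"
  proof
    fix \<gamma> assume "\<gamma> \<in> fixed_roots R x"
    then have \<gamma>: "\<gamma> \<in> R" "x \<gamma> = \<gamma>" by (auto simp: fixed_roots_def)
    have "\<gamma> \<in> P \<or> - \<gamma> \<in> P"
      using f(2) [OF \<gamma>(1)] R(2) [OF \<gamma>(1)] \<gamma> by (auto simp: P additive.minus [OF f(1)])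
    then have "\<gamma> \<in> span ?J"
    proof
      assume "- \<gamma> \<in> P"
      then have "- \<gamma> \<in> span ?J" using pos \<gamma> by (simp add: additive.minus [OF x])
      then show ?thesis using span_neg by fastforce
    qed (use pos \<gamma> in blast)
    then show "\<gamma> \<in> R \<inter> span ?J" using \<gamma> by blast
  qed
  \<comment> \<open>For the other inclusion: \<open>x\<close> is additive, so it fixes the whole
    span of fixed roots.\<close>
  moreover have "x \<gamma> = \<gamma>" if "\<gamma> \<in> span ?J" for \<gamma>
    using that
  proof (induction rule: span_induct_alt)
    case base
    show ?case by (rule additive.zero [OF x])
  next
    case (step n a b)
    then show ?case
      by (simp add: additive.add [OF x] additive_int_scale [OF x] fixed_roots_def)
  qed
  ultimately show ?thesis by (auto simp: fixed_roots_def)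
qed

text \<open>Exit is defined through the signs of \<open>f\<close>, whereas sign convexity concerns
  \<open>g\<close>. On the orbit of a moved root \<open>g\<close> never vanishes, so both signs
  agree and the exit time is the first time at which \<open>g\<close> is negative.\<close>

lemma exit_time_moving:
  assumes x: "bij x" "x ` R = R" and sc: "sign_convex x R g"
    and gz: "\<And>\<gamma>. \<gamma> \<in> R \<Longrightarrow> g \<gamma> = 0 \<longleftrightarrow> x \<gamma> = \<gamma>"
    and \<gamma>: "\<gamma> \<in> P" "x \<gamma> \<noteq> \<gamma>"
  shows "\<exists>n. exit_time P x \<gamma> = enat n \<and> g ((x ^^ n) \<gamma>) < 0 \<and>
    (\<forall>m. g ((x ^^ m) \<gamma>) < 0 \<longrightarrow> n \<le> m)"
proof -
  define Q where "Q i \<longleftrightarrow> i \<ge> 1 \<and> (x ^^ i) \<gamma> \<in> uminus ` P" for i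
  have \<gamma>R: "\<gamma> \<in> R" "g \<gamma> > 0"
    using \<gamma> g_nonneg [OF \<gamma>(1)] gz [of \<gamma>] by (auto simp: P order_less_le)
  have xn: "(x ^^ m) \<gamma> \<in> R" for m by (rule funpow_in [OF equalityD1 [OF x(2)] \<gamma>R(1)])
  have gn: "g ((x ^^ m) \<gamma>) \<noteq> 0" for m
    using sign_convex_zero_iff [OF sc _ \<gamma>R(1)] x(2) \<gamma>R by simp
  have Q: "Q m \<longleftrightarrow> g ((x ^^ m) \<gamma>) < 0" for m
  proof -
    have "f ((x ^^ m) \<gamma>) < 0 \<longleftrightarrow> g ((x ^^ m) \<gamma>) < 0"
      using fg [OF xn gn] by (metis sgn_less)
    \<comment> \<open>The minimum in the exit time starts at 1; time 0 never competes, because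
      \<open>g \<gamma>\<close> is positive.\<close>
    moreover have "m \<noteq> 0" if "g ((x ^^ m) \<gamma>) < 0" using that \<gamma>R by (intro notI) simp
    ultimately show ?thesis using xn [of m] unfolding Q_def uminus_image_positive by auto
  qed
  have "\<gamma> \<notin> stable_roots P x"
    using stable_roots_eq_fixed [OF x sc gz] \<gamma> by (simp add: fixed_roots_def)
  then have e: "exit_time P x \<gamma> = enat (LEAST i. Q i)"
    using \<gamma> by (simp add: exit_time_def Q_def)
  obtain n where "g ((x ^^ n) \<gamma>) * g \<gamma> < 0"
    using sc \<gamma>R unfolding sign_convex_def by fastforce
  then have "Q n" using \<gamma>R by (simp add: Q mult_less_0_iff)
  then have "Q (LEAST i. Q i)" by (rule LeastI)
  then show ?thesis using e Q Least_le [of Q] by blast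
qed

lemma quasi_convex_of_sign_convex:
  assumes x: "bij x" "additive x" "x ` R = R" and sc: "sign_convex x R g"
    and gz: "\<And>\<gamma>. \<gamma> \<in> R \<Longrightarrow> g \<gamma> = 0 \<longleftrightarrow> x \<gamma> = \<gamma>"
  shows "quasi_convex_element R P x"
proof -
  have stable: "stable_roots P x = fixed_roots R x"
    by (rule stable_roots_eq_fixed [OF x(1,3) sc]) (rule gz)
  have par: "\<exists>J\<subseteq>simple_roots P. stable_roots P x = R \<inter> int_span J"
    unfolding stable using fixed_roots_parabolic [OF x(2) gz] by (metis inf_le1)
  have "exit_time P x (\<alpha> + \<beta>) \<le> max (exit_time P x \<alpha>) (exit_time P x \<beta>)"
    if A: "\<alpha> \<in> P" "\<beta> \<in> P" "\<alpha> + \<beta> \<in> P" for \<alpha> \<beta>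
  proof (cases "x \<alpha> = \<alpha> \<or> x \<beta> = \<beta>")
    case True
    then have "\<alpha> \<in> stable_roots P x \<or> \<beta> \<in> stable_roots P x"
      unfolding stable using A by (auto simp: fixed_roots_def P)
    \<comment> \<open>A fixed summand makes the bound infinite, so only pairs of moved roots call
      for sign convexity.\<close>
    then have "exit_time P x \<alpha> = \<infinity> \<or> exit_time P x \<beta> = \<infinity>" by (auto simp: exit_time_def)
    then show ?thesis by auto
  next
    case False
    have RA: "\<alpha> \<in> R" "\<beta> \<in> R" "\<alpha> + \<beta> \<in> R" using A by (auto simp: P)
    have gp: "g \<alpha> > 0" "g \<beta> > 0"
      using False gz [OF RA(1)] gz [OF RA(2)] g_nonneg [OF A(1)] g_nonneg [OF A(2)]
      by (simp_all add: order_less_le)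
    then have "g (\<alpha> + \<beta>) \<noteq> 0" by (simp add: additive.add [OF g])
    then have moved: "x (\<alpha> + \<beta>) \<noteq> \<alpha> + \<beta>" using gz [OF RA(3)] by simp
    have exit: "\<exists>n. exit_time P x \<gamma> = enat n \<and> g ((x ^^ n) \<gamma>) < 0 \<and>
        (\<forall>m. g ((x ^^ m) \<gamma>) < 0 \<longrightarrow> n \<le> m)" if "\<gamma> \<in> P" "x \<gamma> \<noteq> \<gamma>" for \<gamma>
      by (rule exit_time_moving [OF x(1,3) sc _ that]) (rule gz)
    obtain a where a: "exit_time P x \<alpha> = enat a" "g ((x ^^ a) \<alpha>) < 0"
      using exit [OF A(1)] False by blast
    obtain b where b: "exit_time P x \<beta> = enat b" "g ((x ^^ b) \<beta>) < 0"
      using exit [OF A(2)] False by blast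
    obtain m where m: "exit_time P x (\<alpha> + \<beta>) = enat m" "\<And>n. g ((x ^^ n) (\<alpha> + \<beta>)) < 0 \<Longrightarrow> m \<le> n"
      using exit [OF A(3) moved] by blast
    obtain n where "n \<le> max a b" "g ((x ^^ n) (\<alpha> + \<beta>)) < 0"
      using sign_convexD [OF sc RA gp a(2) b(2)] by blast
    then have "m \<le> max a b" using m(2) order_trans by blast
    then show ?thesis unfolding a(1) b(1) m(1) by (simp add: max_def split: if_splits)
  qed
  then show ?thesis using par unfolding quasi_convex_element_def by blast
qed

end

section \<open>Conjugation into the given chamber\<close>

theorem theorem2p2:
  fixes pair :: "'x::ab_group_add \<Rightarrow> 'y::ab_group_add \<Rightarrow> int"
    and \<Phi> \<Phi>p :: "'x set"
    and coroot :: "'x \<Rightarrow> 'y"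
    and \<delta> x :: "'x \<Rightarrow> 'x"
  assumes "root_datum pair \<Phi> coroot"
    and "reduced \<Phi>"
    and "positive_system pair \<Phi> \<Phi>p"
    and "based_automorphism pair \<Phi> coroot \<Phi>p \<delta>"
    and "x \<in> extended_weyl_group pair \<Phi> coroot \<delta>"
  shows "\<exists>w \<in> weyl_group pair \<Phi> coroot. \<exists>y. y = w \<circ> x \<circ> inv w \<and>
           convex_element \<Phi> \<Phi>p y \<and> stable_roots \<Phi>p y = fixed_roots \<Phi> y"
proof -
  note datum = assms(1)
  note fin = finite_roots [OF datum]
  note x = extended_weyl_group_props [OF datum assms(4,5)]
  have separate: "\<exists>q :: 'x \<Rightarrow> real. additive q \<and> q a \<noteq> 0" if "a \<noteq> 0" for a
  proof -
    obtain b where "pair a b \<noteq> 0" using pairing_nondegenerate [OF datum \<open>a \<noteq> 0\<close>] by blast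
    moreover have "additive (\<lambda>a. real_of_int (pair a b))"
      using pairing_additive_left [OF datum, of b] by (simp add: additive_def)
    ultimately show ?thesis by (intro exI [of _ "\<lambda>a. real_of_int (pair a b)"]) simp
  qed
  \<comment> \<open>\<open>q\<close> plays two roles: being nonzero on the roots, it makes
    \<open>f\<close> regular below; being nonzero on the nonzero differences
    \<open>x \<gamma> - \<gamma>\<close>, it separates moved roots from their images, as the Fourier
    argument requires.\<close>
  have "\<exists>q :: 'x \<Rightarrow> real. additive q \<and> (\<forall>a\<in>(\<Phi> \<union> (\<lambda>\<gamma>. x \<gamma> - \<gamma>) ` \<Phi>) - {0}. q a \<noteq> 0)"
    using fin by (intro additive_generic separate) auto
  then obtain q :: "'x \<Rightarrow> real" where q: "additive q"
    "\<And>a. a \<in> (\<Phi> \<union> (\<lambda>\<gamma>. x \<gamma> - \<gamma>) ` \<Phi>) - {0} \<Longrightarrow> q a \<noteq> 0"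
    by blast
  have q_root: "q \<gamma> \<noteq> 0" if "\<gamma> \<in> \<Phi>" for \<gamma>
    using q(2) [of \<gamma>] root_nonzero [OF datum that] that by blast
  have q_moved: "q (x \<gamma>) \<noteq> q \<gamma>" if "\<gamma> \<in> \<Phi>" "x \<gamma> \<noteq> \<gamma>" for \<gamma>
    using q(2) [of "x \<gamma> - \<gamma>"] that by (simp add: additive.diff [OF q(1)])
  obtain g where g: "additive g" "sign_convex x \<Phi> g" "sign_convex (inv x) \<Phi> g"
    "\<And>\<gamma>. \<gamma> \<in> \<Phi> \<Longrightarrow> g \<gamma> = 0 \<longleftrightarrow> x \<gamma> = \<gamma>"
    using exists_sign_convex_functional [OF fin x q(1) q_moved] by blast
  obtain e where e: "e > 0" "\<And>\<gamma>. \<gamma> \<in> \<Phi> \<Longrightarrow> g \<gamma> \<noteq> 0 \<Longrightarrow> sgn (g \<gamma> + e * q \<gamma>) = sgn (g \<gamma>)"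
    using perturb_sign [OF fin, of g q] by blast
  define f where "f = (\<lambda>\<gamma>. g \<gamma> + e * q \<gamma>)"
  have fg: "sgn (f \<gamma>) = sgn (g \<gamma>)" if "\<gamma> \<in> \<Phi>" "g \<gamma> \<noteq> 0" for \<gamma>
    using e that by (simp add: f_def)
  have f: "additive f" using g(1) q(1) by (simp add: f_def additive_def algebra_simps)
  have f0: "f \<gamma> \<noteq> 0" if "\<gamma> \<in> \<Phi>" for \<gamma>
  proof (cases "g \<gamma> = 0")
    case True
    then show ?thesis using e(1) q_root [OF that] by (simp add: f_def)
  next
    case False
    then show ?thesis using fg [OF that] by (metis sgn_0_0)
  qed
  obtain l where l: "\<And>\<alpha>. \<alpha> \<in> \<Phi> \<Longrightarrow> pair \<alpha> l \<noteq> 0" "\<Phi>p = {\<alpha> \<in> \<Phi>. pair \<alpha> l > 0}"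
    using assms(3) by (auto simp: positive_system_def)
  have "additive (\<lambda>a. real_of_int (pair a l))"
    using pairing_additive_left [OF datum, of l] by (simp add: additive_def)
  then obtain u where u: "u \<in> weyl_group pair \<Phi> coroot"
    "\<And>\<alpha>. \<alpha> \<in> \<Phi> \<Longrightarrow> f (u \<alpha>) * real_of_int (pair \<alpha> l) \<ge> 0"
    using weyl_group_same_chamber [OF datum f] by blast
  note up = weyl_group_props [OF datum u(1)]
  have u_root: "u \<gamma> \<in> \<Phi>" if "\<gamma> \<in> \<Phi>" for \<gamma> using up(3) that by blast
  define F G where "F = f \<circ> u" and "G = g \<circ> u"
  \<comment> \<open>Composing \<open>f\<close> and \<open>g\<close> with \<open>u\<close> moves the
    chamber to that of \<open>l\<close>; conjugating \<open>x\<close> by \<open>inv u\<close>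
    transports its orbits accordingly.\<close>
  define y where "y = inv u \<circ> x \<circ> u"
  have P: "\<Phi>p = {\<gamma> \<in> \<Phi>. F \<gamma> > 0}"
  proof -
    \<comment> \<open>The closed chambers agree by the choice of \<open>u\<close>; since neither
      functional vanishes on a root, the open ones agree too.\<close>
    have "pair \<gamma> l > 0 \<longleftrightarrow> F \<gamma> > 0" if "\<gamma> \<in> \<Phi>" for \<gamma>
      using u(2) [OF that] l(1) [OF that] f0 [OF u_root [OF that]]
      by (auto simp: F_def zero_le_mult_iff)
    then show ?thesis using l(2) by auto
  qed
  have F: "additive F" "additive G" using f g(1) up(2) by (auto simp: F_def G_def additive_def)
  have F0: "F \<gamma> \<noteq> 0" if "\<gamma> \<in> \<Phi>" for \<gamma> using f0 u_root [OF that] by (simp add: F_def)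
  have FG: "sgn (F \<gamma>) = sgn (G \<gamma>)" if "\<gamma> \<in> \<Phi>" "G \<gamma> \<noteq> 0" for \<gamma>
    using fg u_root that by (simp add: F_def G_def)
  have iu: "bij (inv u)" "additive (inv u)" "inv u ` \<Phi> = \<Phi>"
    using up bij_imp_bij_inv additive_inv image_inv_eq by blast+
  have y: "bij y" "additive y" "y ` \<Phi> = \<Phi>"
    unfolding y_def
    using additive_automorphism_comp [OF additive_automorphism_comp [OF iu x] up] by blast+
  have inv_y: "inv y = inv u \<circ> inv x \<circ> u"
    using x(1) up(1) iu(1) by (simp add: y_def o_inv_distrib bij_comp inv_inv_eq comp_assoc)
  have sc: "sign_convex y \<Phi> G" "sign_convex (inv y) \<Phi> G"
    unfolding inv_y unfolding y_def G_def
    using sign_convex_conj [OF up(1,2)] up(3) g(2,3) by blast+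
  have Gz: "G \<gamma> = 0 \<longleftrightarrow> y \<gamma> = \<gamma>" if "\<gamma> \<in> \<Phi>" for \<gamma>
    using g(4) [OF u_root [OF that]] up(1) by (auto simp: G_def y_def bij_is_inj bij_is_surj surj_f_inv_f dest: arg_cong [of _ _ u])
  have iy: "bij (inv y)" "additive (inv y)" "inv y ` \<Phi> = \<Phi>"
    using y bij_imp_bij_inv additive_inv image_inv_eq by blast+
  \<comment> \<open>\<open>y\<close> and \<open>inv y\<close> fix the same roots, so one functional
    \<open>G\<close> settles quasi-convexity of both.\<close>
  have iGz: "G \<gamma> = 0 \<longleftrightarrow> inv y \<gamma> = \<gamma>" if "\<gamma> \<in> \<Phi>" for \<gamma>
    using Gz [OF that] y(1) by (metis bij_inv_eq_iff)
  note base = fin uminus_root [OF datum] F(1) F0 P F(2) FG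
  have "convex_element \<Phi> \<Phi>p y"
    unfolding convex_element_def
    using quasi_convex_of_sign_convex [OF base y sc(1) Gz]
      quasi_convex_of_sign_convex [OF base iy sc(2) iGz] by blast
  moreover have "stable_roots \<Phi>p y = fixed_roots \<Phi> y"
    by (rule stable_roots_eq_fixed [OF base y(1,3) sc(1) Gz])
  moreover have "y = inv u \<circ> x \<circ> inv (inv u)"
    using up(1) by (simp add: y_def inv_inv_eq)
  ultimately show ?thesis using weyl_group_inv [OF datum u(1)] by blast
qed

end
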